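(* For every graph $G$ (with $G$ infinite), the tangle compactification $\vartheta G$ is homeomorphic to the inverse limit $\langle\langle G\rangle\rangle=\varprojlim(G_\gamma\mid\gamma\in\Gamma)$.
   Context: $G$ is regarded as a 1-complex: edges are copies of $[0,1]$; inner edge points have their usual neighbourhoods, a basic open neighbourhood of a vertex $u$ is a union of half-open intervals $[u,j_e)$, one for each edge $e$ at $u$. Tangle compactification: $\mathcal X$ is the set of finite subsets of $V(G)$; $\mathcal C_X$ the set of components of $G-X$; for $X\subseteq X'$, $\phi_{X',X}$ sends a component of $G-X'$ to the component of $G-X$ containing it; $\mathcal U_X$ is the set of ultrafilters on $\mathcal C_X$; $f_{X',X}(U')=\{\mathcal C\subseteq\mathcal C_X:\exists\mathcal C'\in U',\ \mathcal C\supseteq\phi_{X',X}[\mathcal C']\}$; $\mathcal U$ is the set of compatible families $(U_X)_{X\in\mathcal X}$ ($f_{X',X}(U_{X'})=U_X$). $\vartheta G=G\cup\mathcal U$ carries the topology generated by the open sets of the 1-complex $G$ and the sets $\bigcup\mathcal C\cup\mathring E(X,\bigcup\mathcal C)\cup\{(U_Y)_Y:\mathcal C\in U_X\}$ ($X\in\mathcal X$, $\mathcal C\subseteq\mathcal C_X$; $\mathring E(X,\bigcup\mathcal C)$ the inner points of edges between $X$ and $\bigcup\mathcal C$). The inverse system: $\Gamma$ is the set of pairs $(X,P)$ with $X\in\mathcal X$ and $P$ a finite partition of $\mathcal C_X$. For $(X,P)\in\Gamma$ let $p(X,P)$ be the partition of $V(G)$ consisting of the singletons $\{x\}$, $x\in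 X$, and the sets $V[\mathcal C]$ (vertex set of $\bigcup\mathcal C$) for $\mathcal C\in P$. Put $(X,P)\le(Y,Q)$ iff $X\subseteq Y$ and $p(Y,Q)$ refines $p(X,P)$; this is a directed partial order. $G/p(X,P)$ is the multigraph on $p(X,P)$ whose edges are the edges of $G$ between distinct classes; classes $\{x\}$ with $x\in X$ are identified with $x$, the other classes are dummy vertices. $G_{(X,P)}$ is the 1-complex ground set of $G/p(X,P)$ with the topology generated by: usual neighbourhoods of inner edge points; for $x\in X$ the sets $\bigcup_{e\ni x}[x,j_e)$; for a dummy vertex $p$ the sets $(\mathring E(X,p)\cup\{p\})\setminus\bigcup_{e\in F}(x_e,j_e]$, where $\mathring E(X,p)$ is the set of inner points of edges between $X$ and $p$, $F$ is a finite set of such edges, $x_e$ is the endvertex of $e$ in $X$ and $j_e$ an inner point of $e$. For $(X,P)\le(X',P')$ the bonding map $G_{(X',P')}\to G_{(X,P)}$ sends each vertex of $G/p(X',P')$ to the vertex of $G/p(X,P)$ including it, is the identity on the interiors of edges of $G/p(X',P')$ that are also edges of $G/p(X,P)$, and sends every other edge of $G/p(X',P')$ to the dummy vertex of $G/p(X,P)$ containing both its endvertices. *)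

theory Defs
  imports "HOL-Analysis.Analysis" "HOL-Library.Disjoint_Sets" "HOL-Library.FuncSet"
begin

definition simple_graph :: "'a set \<Rightarrow> 'a set set \<Rightarrow> bool" where
  "simple_graph V E \<longleftrightarrow> (\<forall>e\<in>E. \<exists>u\<in>V. \<exists>v\<in>V. u \<noteq> v \<and> e = {u, v})"

definition edges_between :: "'a set set \<Rightarrow> 'a set \<Rightarrow> 'a set \<Rightarrow> 'a set set" where
  "edges_between E A B = {e \<in> E. \<exists>u\<in>A. \<exists>v\<in>B. e = {u, v}}"

definition finite_vertex_sets :: "'a set \<Rightarrow> 'a set set" where
  "finite_vertex_sets V = {X. X \<subseteq> V \<and> finite X}"

text \<open>A component of \<open>G - X\<close> is represented by its vertex set; as a subgraph it is the
  subgraph induced on that set.\<close>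

definition connected_in_minus :: "'a set \<Rightarrow> 'a set set \<Rightarrow> 'a set \<Rightarrow> ('a \<times> 'a) set" where
  "connected_in_minus V E X =
     {(u, v). u \<in> V - X \<and> v \<in> V - X \<and>
        (u, v) \<in> {(a, b). a \<in> V - X \<and> b \<in> V - X \<and> {a, b} \<in> E}\<^sup>*}"

definition comps :: "'a set \<Rightarrow> 'a set set \<Rightarrow> 'a set \<Rightarrow> 'a set set" where
  "comps V E X = (V - X) // connected_in_minus V E X"

text \<open>\<open>Inner e t\<close> with \<open>0 < t < 1\<close> is the inner point of the edge \<open>e\<close> at distance \<open>t\<close> from an
  arbitrarily chosen endvertex \<open>edge_base e\<close>. The vertices have their own type because the
  vertices of the quotient multigraphs below are classes of vertices of \<open>G\<close>, while their edges
  are edges of \<open>G\<close>.\<close>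

datatype ('v, 'e) cpoint = Vertex 'v | Inner 'e real

definition edge_base :: "'a set \<Rightarrow> 'a" where
  "edge_base e = (SOME u. u \<in> e)"

text \<open>The inner point of \<open>e\<close> at distance \<open>s\<close> from its endvertex \<open>u\<close>. Hence, if \<open>j\<close> is the inner
  point at distance \<open>r\<close> from \<open>u\<close>, the interval \<open>(u, j)\<close> is the image of \<open>{0<..<r}\<close> and
  \<open>(u, j]\<close> is the image of \<open>{0<..r}\<close>.\<close>

definition at_dist :: "'a \<Rightarrow> 'a set \<Rightarrow> real \<Rightarrow> ('v, 'a set) cpoint" where
  "at_dist u e s = Inner e (if u = edge_base e then s else 1 - s)"

definition inner_points :: "'a set set \<Rightarrow> ('v, 'a set) cpoint set" where
  "inner_points F = (\<Union>e\<in>F. Inner e ` {0<..<1})"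

definition edge_intervals :: "'a set set \<Rightarrow> ('v, 'a set) cpoint set set" where
  "edge_intervals F = {Inner e ` {a<..<b} | e a b. e \<in> F \<and> 0 \<le> a \<and> a < b \<and> b \<le> 1}"

text \<open>The unions of half-open intervals \<open>[u, j\<^sub>e)\<close>, one for each edge \<open>e \<in> F\<close> at \<open>u\<close>; the
  argument \<open>v\<close> is the vertex of the 1-complex that \<open>u\<close> corresponds to.\<close>

definition vertex_stars :: "'a set set \<Rightarrow> 'a \<Rightarrow> 'v \<Rightarrow> ('v, 'a set) cpoint set set" where
  "vertex_stars F u v =
     {insert (Vertex v) (\<Union>e\<in>{e\<in>F. u \<in> e}. at_dist u e ` {0<..<j e}) | j.
        \<forall>e. 0 < j e \<and> j e < (1::real)}"

definition complex_points :: "'a set \<Rightarrow> 'a set set \<Rightarrow> ('a, 'a set) cpoint set" where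
  "complex_points V E = Vertex ` V \<union> inner_points E"

definition one_complex :: "'a set \<Rightarrow> 'a set set \<Rightarrow> ('a, 'a set) cpoint topology" where
  "one_complex V E = topology_generated_by (edge_intervals E \<union> (\<Union>u\<in>V. vertex_stars E u u))"

definition ultrafilter_on :: "'b set \<Rightarrow> 'b set set \<Rightarrow> bool" where
  "ultrafilter_on S U \<longleftrightarrow>
     U \<subseteq> Pow S \<and> S \<in> U \<and> {} \<notin> U \<and>
     (\<forall>A\<in>U. \<forall>B\<in>U. A \<inter> B \<in> U) \<and>
     (\<forall>A\<in>U. \<forall>B. A \<subseteq> B \<and> B \<subseteq> S \<longrightarrow> B \<in> U) \<and>
     (\<forall>A. A \<subseteq> S \<longrightarrow> A \<in> U \<or> S - A \<in> U)"

definition comp_map :: "'a set \<Rightarrow> 'a set set \<Rightarrow> 'a set \<Rightarrow> 'a set \<Rightarrow> 'a set" where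
  "comp_map V E X C' = (THE C. C \<in> comps V E X \<and> C' \<subseteq> C)"

definition ultrafilter_map ::
    "'a set \<Rightarrow> 'a set set \<Rightarrow> 'a set \<Rightarrow> 'a set set set \<Rightarrow> 'a set set set" where
  "ultrafilter_map V E X U' =
     {\<C>. \<C> \<subseteq> comps V E X \<and> (\<exists>\<C>'\<in>U'. comp_map V E X ` \<C>' \<subseteq> \<C>)}"

definition ultrafilter_tangles :: "'a set \<Rightarrow> 'a set set \<Rightarrow> ('a set \<Rightarrow> 'a set set set) set" where
  "ultrafilter_tangles V E =
     {U \<in> (\<Pi>\<^sub>E X\<in>finite_vertex_sets V. {W. ultrafilter_on (comps V E X) W}).
        \<forall>X\<in>finite_vertex_sets V. \<forall>X'\<in>finite_vertex_sets V.
          X \<subseteq> X' \<longrightarrow> ultrafilter_map V E X (U X') = U X}"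

type_synonym 'a tpoint = "('a, 'a set) cpoint + ('a set \<Rightarrow> 'a set set set)"

definition tangle_basic ::
    "'a set \<Rightarrow> 'a set set \<Rightarrow> 'a set \<Rightarrow> 'a set set \<Rightarrow> 'a tpoint set" where
  "tangle_basic V E X \<C> =
     Inl ` ((\<Union>C\<in>\<C>. complex_points C {e\<in>E. e \<subseteq> C}) \<union> inner_points (edges_between E X (\<Union>\<C>)))
     \<union> Inr ` {U \<in> ultrafilter_tangles V E. \<C> \<in> U X}"

definition tangle_compactification :: "'a set \<Rightarrow> 'a set set \<Rightarrow> 'a tpoint topology" where
  "tangle_compactification V E =
     topology_generated_by
       ({Inl ` S | S. openin (one_complex V E) S} \<union>
        {tangle_basic V E X \<C> | X \<C>. X \<in> finite_vertex_sets V \<and> \<C> \<subseteq> comps V E X})"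

definition inverse_limit ::
    "'i set \<Rightarrow> ('i \<Rightarrow> 'i \<Rightarrow> bool) \<Rightarrow> ('i \<Rightarrow> 'b topology) \<Rightarrow> ('i \<Rightarrow> 'i \<Rightarrow> 'b \<Rightarrow> 'b)
      \<Rightarrow> ('i \<Rightarrow> 'b) topology" where
  "inverse_limit I le T f =
     subtopology (product_topology T I)
       {x. \<forall>i\<in>I. \<forall>j\<in>I. le i j \<longrightarrow> f j i (x j) = x i}"

type_synonym 'a gidx = "'a set \<times> 'a set set set"

definition index_set :: "'a set \<Rightarrow> 'a set set \<Rightarrow> 'a gidx set" where
  "index_set V E =
     {(X, P). X \<in> finite_vertex_sets V \<and> finite P \<and> partition_on (comps V E X) P}"

definition dummies :: "'a gidx \<Rightarrow> 'a set set" where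
  "dummies \<gamma> = Union ` snd \<gamma>"

definition vpart :: "'a gidx \<Rightarrow> 'a set set" where
  "vpart \<gamma> = (\<lambda>x. {x}) ` fst \<gamma> \<union> dummies \<gamma>"

definition index_le :: "'a set \<Rightarrow> 'a gidx \<Rightarrow> 'a gidx \<Rightarrow> bool" where
  "index_le V \<gamma> \<delta> \<longleftrightarrow> fst \<gamma> \<subseteq> fst \<delta> \<and> refines V (vpart \<delta>) (vpart \<gamma>)"

definition quot_edges :: "'a set set \<Rightarrow> 'a gidx \<Rightarrow> 'a set set" where
  "quot_edges E \<gamma> = (\<Union>p\<in>vpart \<gamma>. \<Union>q\<in>vpart \<gamma> - {p}. edges_between E p q)"

definition quot_points :: "'a set set \<Rightarrow> 'a gidx \<Rightarrow> ('a set, 'a set) cpoint set" where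
  "quot_points E \<gamma> = Vertex ` vpart \<gamma> \<union> inner_points (quot_edges E \<gamma>)"

text \<open>For an edge \<open>e\<close> between \<open>X\<close> and a dummy vertex, \<open>e \<inter> X\<close> consists of exactly one vertex,
  so the inner union below runs over the single endvertex \<open>x\<^sub>e\<close> of \<open>e\<close> in \<open>X\<close>.\<close>

definition dummy_nbhds ::
    "'a set set \<Rightarrow> 'a set \<Rightarrow> 'a set \<Rightarrow> ('a set, 'a set) cpoint set set" where
  "dummy_nbhds E X p =
     {insert (Vertex p) (inner_points (edges_between E X p))
        - (\<Union>e\<in>F. \<Union>x\<in>e \<inter> X. at_dist x e ` {0<..j e}) | F j.
        finite F \<and> F \<subseteq> edges_between E X p \<and> (\<forall>e. 0 < j e \<and> j e < (1::real))}"

text \<open>The class \<open>{x}\<close> with \<open>x \<in> X\<close> plays the role of the vertex \<open>x\<close>.\<close>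

definition quot_complex :: "'a set set \<Rightarrow> 'a gidx \<Rightarrow> ('a set, 'a set) cpoint topology" where
  "quot_complex E \<gamma> =
     topology_generated_by
       (edge_intervals (quot_edges E \<gamma>)
        \<union> (\<Union>x\<in>fst \<gamma>. vertex_stars (quot_edges E \<gamma>) x {x})
        \<union> (\<Union>p\<in>dummies \<gamma>. dummy_nbhds E (fst \<gamma>) p))"

definition bonding_map ::
    "'a set set \<Rightarrow> 'a gidx \<Rightarrow> 'a gidx \<Rightarrow> ('a set, 'a set) cpoint \<Rightarrow> ('a set, 'a set) cpoint" where
  "bonding_map E \<delta> \<gamma> z =
     (case z of
        Vertex q \<Rightarrow> Vertex (THE p. p \<in> vpart \<gamma> \<and> q \<subseteq> p)
      | Inner e t \<Rightarrow>
          if e \<in> quot_edges E \<gamma> then Inner e t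
          else Vertex (THE p. p \<in> dummies \<gamma> \<and> e \<subseteq> p))"

definition graph_inverse_limit ::
    "'a set \<Rightarrow> 'a set set \<Rightarrow> ('a gidx \<Rightarrow> ('a set, 'a set) cpoint) topology" where
  "graph_inverse_limit V E =
     inverse_limit (index_set V E) (index_le V) (quot_complex E) (bonding_map E)"

lemma comps_partition: "partition_on (V - X) (comps V E X)"
proof -
  let ?r = "{(a, b). a \<in> V - X \<and> b \<in> V - X \<and> {a, b} \<in> E}"
  have "sym ?r" by (auto simp: sym_def insert_commute)
  then have "sym (?r\<^sup>*)" by (rule sym_rtrancl)
  then have "equiv (V - X) (connected_in_minus V E X)"
    by (auto simp: equiv_def refl_on_def sym_def trans_def connected_in_minus_def)
  then show ?thesis unfolding comps_def by (rule partition_on_quotient)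
qed

lemma Union_comps: "\<Union>(comps V E X) = V - X"
  by (rule partition_onD1[OF comps_partition, symmetric])

lemma vpart_partition:
  assumes "\<gamma> \<in> index_set V E"
  shows "partition_on V (vpart \<gamma>)"
proof -
  obtain X P where g: "\<gamma> = (X, P)" by (cases \<gamma>)
  have X: "X \<subseteq> V" and P: "partition_on (comps V E X) P"
    using assms by (auto simp: g index_set_def finite_vertex_sets_def)
  have C: "partition_on (V - X) (comps V E X)" by (rule comps_partition)
  have UP: "\<Union>P = comps V E X" using P by (simp add: partition_on_def)
  have "\<Union>(Union ` P) = \<Union>(\<Union>P)" by blast
  then have "\<Union>(Union ` P) = V - X" using UP Union_comps[of V E X] by simp
  then have un: "\<Union>(vpart \<gamma>) = V" using X by (auto simp: vpart_def dummies_def g)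
  have ne: "\<Union>\<C> \<noteq> {}" if "\<C> \<in> P" for \<C>
  proof -
    have "\<C> \<noteq> {}" "\<C> \<subseteq> comps V E X" using that P UP by (auto simp: partition_on_def)
    then obtain D where "D \<in> \<C>" "D \<noteq> {}" using C by (auto simp: partition_on_def)
    then show ?thesis by blast
  qed
  have dis: "\<Union>\<C> \<inter> \<Union>\<D> = {}" if "\<C> \<in> P" "\<D> \<in> P" "\<C> \<noteq> \<D>" for \<C> \<D>
  proof -
    have 1: "\<C> \<inter> \<D> = {}" using that P by (auto simp: partition_on_def disjoint_def)
    have 2: "\<C> \<subseteq> comps V E X" "\<D> \<subseteq> comps V E X" using that UP by auto
    have 3: "A \<inter> B = {}" if "A \<in> \<C>" "B \<in> \<D>" for A B
    proof -
      have "A \<noteq> B" "A \<in> comps V E X" "B \<in> comps V E X" using 1 2 that by auto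
      then show ?thesis using C by (auto simp: partition_on_def disjoint_def)
    qed
    then show ?thesis by blast
  qed
  have "disjoint (vpart \<gamma>)"
  proof (rule disjointI)
    fix p q assume pq: "p \<in> vpart \<gamma>" "q \<in> vpart \<gamma>" "p \<noteq> q"
    have avoid: "\<Union>\<C> \<inter> X = {}" if "\<C> \<in> P" for \<C>
      using that UP Union_comps[of V E X] by blast
    consider x y where "p = {x}" "q = {y}"
      | x \<D> where "p = {x}" "x \<in> X" "q = \<Union>\<D>" "\<D> \<in> P"
      | \<C> y where "p = \<Union>\<C>" "\<C> \<in> P" "q = {y}" "y \<in> X"
      | \<C> \<D> where "p = \<Union>\<C>" "\<C> \<in> P" "q = \<Union>\<D>" "\<D> \<in> P"
      using pq(1,2) by (auto simp: vpart_def dummies_def g)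
    then show "p \<inter> q = {}"
    proof cases
      case 1 then show ?thesis using pq(3) by auto
    next
      case 2 then show ?thesis using avoid by blast
    next
      case 3 then show ?thesis using avoid by blast
    next
      case 4 then show ?thesis using dis pq(3) by metis
    qed
  qed
  then show ?thesis using un ne by (force simp: partition_on_def vpart_def dummies_def g)
qed

lemma at_dist_in_inner_points:
  assumes "e \<in> F" "0 < s" "s < 1"
  shows "at_dist u e s \<in> inner_points F"
  using assms unfolding at_dist_def inner_points_def by (intro UN_I[of e] imageI) auto

lemma Union_edge_intervals:
  "\<Union>(edge_intervals F) = (inner_points F :: ('v, 'a set) cpoint set)"
proof
  show "\<Union>(edge_intervals F) \<subseteq> (inner_points F :: ('v, 'a set) cpoint set)"
    by (force simp: edge_intervals_def inner_points_def)
  have "Inner e ` {0<..<1} \<in> (edge_intervals F :: ('v, 'a set) cpoint set set)" if "e \<in> F" for e :: "'a set"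
    using that unfolding edge_intervals_def by force
  then show "inner_points F \<subseteq> (\<Union>(edge_intervals F) :: ('v, 'a set) cpoint set)"
    by (auto simp: inner_points_def)
qed

lemma vertex_stars_subset:
  fixes S :: "('v, 'a set) cpoint set"
  assumes "S \<in> vertex_stars F u v"
  shows "S \<subseteq> insert (Vertex v) (inner_points F)" and "Vertex v \<in> S"
proof -
  obtain j where j: "S = insert (Vertex v) (\<Union>e\<in>{e\<in>F. u \<in> e}. at_dist u e ` {0<..<j e})"
      "\<And>e. 0 < j e \<and> j e < (1::real)"
    using assms unfolding vertex_stars_def by blast
  have "at_dist u e s \<in> (inner_points F :: ('v, 'a set) cpoint set)"
    if "e \<in> F" "0 < s" "s < j e" for e s
    using that j(2)[of e] by (intro at_dist_in_inner_points) auto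
  then show "S \<subseteq> insert (Vertex v) (inner_points F)" by (auto simp: j(1))
  show "Vertex v \<in> S" by (simp add: j(1))
qed

lemma vertex_stars_nonempty: "vertex_stars F u v \<noteq> {}"
proof -
  have "insert (Vertex v) (\<Union>e\<in>{e\<in>F. u \<in> e}. at_dist u e ` {0<..<1/2}) \<in> vertex_stars F u v"
    unfolding vertex_stars_def by (intro CollectI exI[of _ "\<lambda>_. 1/2"]) simp
  then show ?thesis by blast
qed

lemma topspace_one_complex: "topspace (one_complex V E) = complex_points V E"
proof -
  have "\<Union>(\<Union>u\<in>V. vertex_stars E u u) \<subseteq> Vertex ` V \<union> inner_points E"
    by (blast dest: vertex_stars_subset(1)[THEN subsetD])
  moreover have "Vertex ` V \<subseteq> \<Union>(\<Union>u\<in>V. vertex_stars E u u)"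
  proof -
    have "\<exists>S\<in>vertex_stars E u u. Vertex u \<in> S" for u
      using vertex_stars_subset(2) vertex_stars_nonempty by (metis ex_in_conv)
    then show ?thesis by blast
  qed
  moreover have "i \<union> s = a \<union> i" if "s \<subseteq> a \<union> i" "a \<subseteq> s" for i s a :: "('a, 'a set) cpoint set"
    using that by blast
  ultimately show ?thesis
    unfolding one_complex_def topology_generated_by_topspace complex_points_def Union_Un_distrib
      Union_edge_intervals by simp
qed

lemma topspace_quot_complex:
  assumes "\<gamma> \<in> index_set V E"
  shows "topspace (quot_complex E \<gamma>) = quot_points E \<gamma>"
proof -
  let ?Q = "quot_edges E \<gamma>"
  have sub: "edges_between E (fst \<gamma>) p \<subseteq> ?Q" if p: "p \<in> dummies \<gamma>" for p
  proof
    fix e assume e: "e \<in> edges_between E (fst \<gamma>) p"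
    then obtain x v where x: "x \<in> fst \<gamma>" "v \<in> p" "e = {x, v}" "e \<in> E"
      by (auto simp: edges_between_def)
    obtain \<C> where "\<C> \<in> snd \<gamma>" "p = \<Union>\<C>" using p by (auto simp: dummies_def)
    then have "p \<subseteq> V - fst \<gamma>"
      using assms Union_comps[of V E "fst \<gamma>"] by (fastforce simp: index_set_def partition_on_def)
    then have "p \<in> vpart \<gamma> - {{x}}" "{x} \<in> vpart \<gamma>" using p x by (auto simp: vpart_def)
    moreover have "e \<in> edges_between E {x} p" using x by (auto simp: edges_between_def)
    ultimately show "e \<in> ?Q" unfolding quot_edges_def by blast
  qed
  have un: "i \<union> s \<union> d = a \<union> b \<union> i"
    if "s \<subseteq> a \<union> i" "a \<subseteq> s" "d \<subseteq> b \<union> i" "b \<subseteq> d" for i s d a b :: "('a set, 'a set) cpoint set"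
    using that by blast
  have d1: "S \<subseteq> insert (Vertex p) (inner_points ?Q)"
    if "p \<in> dummies \<gamma>" "S \<in> dummy_nbhds E (fst \<gamma>) p" for S p
  proof -
    have "S \<subseteq> insert (Vertex p) (inner_points (edges_between E (fst \<gamma>) p))"
      using that(2) by (auto simp: dummy_nbhds_def)
    then show ?thesis using sub[OF that(1)] by (fastforce simp: inner_points_def)
  qed
  have d2: "\<exists>S\<in>dummy_nbhds E (fst \<gamma>) p. Vertex p \<in> S" for p
  proof -
    have "insert (Vertex p) (inner_points (edges_between E (fst \<gamma>) p))
        - (\<Union>e\<in>{}. \<Union>x\<in>e \<inter> fst \<gamma>. at_dist x e ` {0<..1/2}) \<in> dummy_nbhds E (fst \<gamma>) p"
      (is "?S \<in> _")
      unfolding dummy_nbhds_def by (intro CollectI exI[of _ "{}"] exI[of _ "\<lambda>_. 1/2"]) simp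
    moreover have "Vertex p \<in> ?S" by simp
    ultimately show ?thesis by (rule bexI[rotated])
  qed
  have s1: "\<Union>(\<Union>x\<in>fst \<gamma>. vertex_stars ?Q x {x}) \<subseteq> Vertex ` (\<lambda>x. {x}) ` fst \<gamma> \<union> inner_points ?Q"
    by (blast dest: vertex_stars_subset(1)[THEN subsetD])
  have s0: "\<exists>S\<in>vertex_stars ?Q x {x}. Vertex {x} \<in> S" for x
    using vertex_stars_subset(2) vertex_stars_nonempty by (metis ex_in_conv)
  have s2: "Vertex ` (\<lambda>x. {x}) ` fst \<gamma> \<subseteq> \<Union>(\<Union>x\<in>fst \<gamma>. vertex_stars ?Q x {x})"
  proof clarify
    fix x assume x: "x \<in> fst \<gamma>"
    from s0[of x] obtain S where "S \<in> vertex_stars ?Q x {x}" "Vertex {x} \<in> S" ..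
    with x show "Vertex {x} \<in> \<Union>(\<Union>x\<in>fst \<gamma>. vertex_stars ?Q x {x})"
      by (intro UnionI[of S] UN_I[of x])
  qed
  have d3: "\<Union>(\<Union>p\<in>dummies \<gamma>. dummy_nbhds E (fst \<gamma>) p) \<subseteq> Vertex ` dummies \<gamma> \<union> inner_points ?Q"
    by (blast dest: d1[THEN subsetD])
  have d4: "Vertex ` dummies \<gamma> \<subseteq> \<Union>(\<Union>p\<in>dummies \<gamma>. dummy_nbhds E (fst \<gamma>) p)"
  proof clarify
    fix p assume p: "p \<in> dummies \<gamma>"
    from d2[of p] obtain S where "S \<in> dummy_nbhds E (fst \<gamma>) p" "Vertex p \<in> S" ..
    with p show "Vertex p \<in> \<Union>(\<Union>p\<in>dummies \<gamma>. dummy_nbhds E (fst \<gamma>) p)"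
      by (intro UnionI[of S] UN_I[of p])
  qed
  show ?thesis
    unfolding quot_complex_def topology_generated_by_topspace quot_points_def Union_Un_distrib
      Union_edge_intervals vpart_def image_Un
    using s1 s2 d3 d4 by (rule un)
qed

lemma topspace_tangle_compactification:
  "topspace (tangle_compactification V E) =
    Inl ` complex_points V E \<union> Inr ` ultrafilter_tangles V E"
proof -
  have un: "s \<union> t = a \<union> b" if "a \<subseteq> s" "s \<subseteq> a" "b \<subseteq> t" "t \<subseteq> a \<union> b" for s t a b :: "'a tpoint set"
    using that by blast
  have sub: "tangle_basic V E X \<C> \<subseteq> Inl ` complex_points V E \<union> Inr ` ultrafilter_tangles V E"
    if "\<C> \<subseteq> comps V E X" for X \<C>
  proof -
    have C: "C \<subseteq> V" if "C \<in> \<C>" for C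
      using Union_comps[of V E X] that \<open>\<C> \<subseteq> comps V E X\<close> by blast
    have "complex_points C {e\<in>E. e \<subseteq> C} \<subseteq> complex_points V E" if "C \<in> \<C>" for C
      using C[OF that] by (auto simp: complex_points_def inner_points_def)
    moreover have "inner_points (edges_between E X (\<Union>\<C>)) \<subseteq> complex_points V E"
      by (auto simp: complex_points_def inner_points_def edges_between_def)
    ultimately show ?thesis unfolding tangle_basic_def by blast
  qed
  have "openin (one_complex V E) (complex_points V E)"
    using openin_topspace[of "one_complex V E"] by (simp add: topspace_one_complex)
  then have a: "Inl ` complex_points V E \<subseteq> \<Union>{Inl ` S | S. openin (one_complex V E) S}"
    by blast
  have b: "\<Union>{Inl ` S | S. openin (one_complex V E) S} \<subseteq> Inl ` complex_points V E"
    using openin_subset[of "one_complex V E"] by (auto simp: topspace_one_complex)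
  have e: "{} \<in> finite_vertex_sets V" by (simp add: finite_vertex_sets_def)
  have "comps V E {} \<in> U {}" if "U \<in> ultrafilter_tangles V E" for U
    using that e unfolding ultrafilter_tangles_def ultrafilter_on_def by blast
  then have "Inr ` ultrafilter_tangles V E \<subseteq> tangle_basic V E {} (comps V E {})"
    by (auto simp: tangle_basic_def)
  then have c: "Inr ` ultrafilter_tangles V E \<subseteq>
      \<Union>{tangle_basic V E X \<C> | X \<C>. X \<in> finite_vertex_sets V \<and> \<C> \<subseteq> comps V E X}"
    using e by blast
  have d: "\<Union>{tangle_basic V E X \<C> | X \<C>. X \<in> finite_vertex_sets V \<and> \<C> \<subseteq> comps V E X} \<subseteq>
      Inl ` complex_points V E \<union> Inr ` ultrafilter_tangles V E"
    using sub by blast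
  show ?thesis
    unfolding tangle_compactification_def topology_generated_by_topspace Union_Un_distrib
    using a b c d by (rule un)
qed

end

theory Submission
  imports Defs
begin

text \<open>
  For an index \<open>\<gamma> = (X, P)\<close> the graph \<open>G\<close> maps to \<open>G\<^sub>\<gamma>\<close> by contracting, and an ultrafilter tangle
  \<open>U\<close> maps to the dummy vertex of the unique block of \<open>P\<close> that belongs to \<open>U X\<close>. These maps are
  compatible and separate points. Conversely, since \<open>\<Gamma>\<close> is directed, a point of the inverse limit
  with an inner edge point or a vertex of \<open>X\<close> as some coordinate comes from that point of \<open>G\<close>; if all
  coordinates are dummy vertices, the unions of components containing the dummy at some \<open>(X, P)\<close> form
  an ultrafilter for each \<open>X\<close>, and these are compatible. Finally the preimages of the generating open
  sets of the \<open>G\<^sub>\<gamma>\<close> are, on the one hand, open in the tangle compactification and, on the other hand,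
  include all of its generating open sets, so the bijection is a homeomorphism. (The spaces need not
  be Hausdorff, so compactness would not give the latter for free.)
\<close>

section \<open>Points of 1-complexes and generated topologies\<close>

text \<open>Finiteness of the partitions makes the projection of a tangle well defined, since an
  ultrafilter contains exactly one block of a finite partition; partitions into at most two blocks
  already recover the ultrafilter. The topologies are compared generator by generator because the
  preimages are explicit. An edge interval or a star at a vertex of X pulls back to the same
  interval or star in G, and a dummy neighbourhood with no edge trimmed pulls back to the basic set
  of its block. Every interval and star of G, and every basic set of a nonempty family of
  components, arises in this way. The hard preimage is that of a dummy neighbourhood with trimmed
  edges. It is the union of an open set of the 1-complex and an untrimmed basic set over a larger
  vertex set: adding the finitely many ends of trimmed edges to X loses no tangle, while each edge
  met by the new basic set has an end outside the enlarged set and hence is not trimmed.\<close>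

lemma inner_points_iff [simp]:
  "Inner e t \<in> inner_points F \<longleftrightarrow> e \<in> F \<and> 0 < t \<and> t < 1" "Vertex v \<notin> inner_points F"
  unfolding inner_points_def by (auto simp: image_iff)

lemma complex_points_iff [simp]:
  "Vertex v \<in> complex_points V E \<longleftrightarrow> v \<in> V"
  "Inner e t \<in> complex_points V E \<longleftrightarrow> e \<in> E \<and> 0 < t \<and> t < 1"
  by (auto simp: complex_points_def)

text \<open>The inverse coordinate of \<open>at_dist u e\<close>. It lets membership in an interval
  starting at \<open>u\<close> be expressed without a case split on which end of the edge is
  \<open>edge_base e\<close>.\<close>

definition dist_from :: "'a \<Rightarrow> 'a set \<Rightarrow> real \<Rightarrow> real" where
  "dist_from u e t = (if u = edge_base e then t else 1 - t)"

lemma Inner_in_at_dist_image [simp]: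
  "Inner e t \<in> at_dist u e' ` A \<longleftrightarrow> e = e' \<and> dist_from u e t \<in> A"
proof
  assume "e = e' \<and> dist_from u e t \<in> A"
  moreover from this have "Inner e t = at_dist u e' (dist_from u e t)" by (auto simp: at_dist_def dist_from_def)
  ultimately show "Inner e t \<in> at_dist u e' ` A" by blast
qed (auto simp: at_dist_def dist_from_def)

lemma Vertex_notin_at_dist_image [simp]: "Vertex v \<notin> at_dist u e ` A"
  by (auto simp: at_dist_def)

text \<open>The base of an edge is one of its two ends, so exactly one of the two distances is the
  parameter \<open>t\<close> itself.\<close>

lemma dist_from_other_end:
  assumes "e = {x, u}" "x \<noteq> u"
  shows "dist_from x e t = 1 - dist_from u e t"
proof -
  have "edge_base e \<in> e" using assms(1) unfolding edge_base_def by (metis insertI1 someI)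
  then show ?thesis using assms by (auto simp: dist_from_def)
qed

lemma Inner_in_image [simp]: "Inner e t \<in> Inner e' ` A \<longleftrightarrow> e = e' \<and> t \<in> A"
  by auto

lemma Inl_in_image_Inl [simp]: "Inl w \<in> Inl ` A \<longleftrightarrow> w \<in> A" "Inr u \<notin> Inl ` A"
  by auto

text \<open>Images commute with unions always, but with finite intersections only under injectivity.
  With it, openness of a map can be tested on a subbasis.\<close>

lemma openin_image_generated:
  assumes "generate_topology_on \<S> S" "inj_on f (\<Union>\<S>)" "\<And>B. B \<in> \<S> \<Longrightarrow> openin T (f ` B)"
  shows "openin T (f ` S)"
proof -
  \<comment> \<open>The inclusion is carried through the induction because injectivity is available
    only on the union of the subbasis.\<close>
  have "S \<subseteq> \<Union>\<S> \<and> openin T (f ` S)"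
    using assms(1)
  proof induction
    case (Int a b)
    then have "f ` (a \<inter> b) = f ` a \<inter> f ` b" using inj_on_image_Int[OF assms(2)] by blast
    then show ?case using Int by auto
  next
    case (UN K)
    then show ?case by (auto simp: image_Union)
  next
    case (Basis B)
    then show ?case using assms(3) by blast
  qed simp
  then show ?thesis ..
qed

text \<open>A star may use a different radius on each incident edge, so no uniform radius is
  required and openness can be tested one edge at a time.\<close>

lemma openin_one_complexI:
  assumes sub: "S \<subseteq> complex_points V E"
    and inner: "\<And>e t. Inner e t \<in> S \<Longrightarrow> \<exists>a b. 0 \<le> a \<and> a < t \<and> t < b \<and> b \<le> 1 \<and> Inner e ` {a<..<b} \<subseteq> S"
    and vertex: "\<And>u e. Vertex u \<in> S \<Longrightarrow> e \<in> E \<Longrightarrow> u \<in> e \<Longrightarrow>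
      \<exists>r. 0 < r \<and> r < 1 \<and> at_dist u e ` {0<..<r} \<subseteq> S"
  shows "openin (one_complex V E) S"
proof (subst openin_subopen, intro ballI)
  fix w assume w: "w \<in> S"
  show "\<exists>T. openin (one_complex V E) T \<and> w \<in> T \<and> T \<subseteq> S"
  proof (cases w)
    case (Vertex u)
    then have u: "u \<in> V" using w sub by (metis complex_points_iff(1) subsetD)
    have "\<exists>r. 0 < r \<and> r < 1 \<and> (e \<in> E \<and> u \<in> e \<longrightarrow> at_dist u e ` {0<..<r} \<subseteq> S)" for e
    proof (cases "e \<in> E \<and> u \<in> e")
      case True
      then show ?thesis using vertex[of u e] w Vertex by blast
    next
      case False
      \<comment> \<open>\<open>vertex_stars\<close> asks for a radius strictly between 0 and 1 at
        every set \<open>e\<close>; sets that are not edges at \<open>u\<close> receive this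
        default.\<close>
      then show ?thesis by (intro exI[of _ "1/2"]) auto
    qed
    then obtain j where j: "\<And>e. 0 < j e \<and> j e < 1 \<and> (e \<in> E \<and> u \<in> e \<longrightarrow> at_dist u e ` {0<..<j e} \<subseteq> S)"
      by metis
    define T where "T = insert (Vertex u) (\<Union>e\<in>{e\<in>E. u \<in> e}. at_dist u e ` {0<..<j e})"
    have "T \<in> vertex_stars E u u" unfolding vertex_stars_def T_def using j by blast
    then have "openin (one_complex V E) T"
      unfolding one_complex_def using u by (intro topology_generated_by_Basis) blast
    moreover have "T \<subseteq> S" using j w Vertex unfolding T_def by blast
    ultimately show ?thesis using Vertex by (auto simp: T_def)
  next
    case (Inner e t)
    then obtain a b where ab: "0 \<le> a" "a < t" "t < b" "b \<le> 1" "Inner e ` {a<..<b} \<subseteq> S" using inner w by blast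
    have "e \<in> E" using w sub Inner by (metis complex_points_iff(2) subsetD)
    moreover have "a < b" using ab by simp
    ultimately have "Inner e ` {a<..<b} \<in> edge_intervals E" using ab unfolding edge_intervals_def by blast
    then have "openin (one_complex V E) (Inner e ` {a<..<b})"
      unfolding one_complex_def by (intro topology_generated_by_Basis) blast
    then show ?thesis using ab Inner by (intro exI[of _ "Inner e ` {a<..<b}"]) simp
  qed
qed

lemma ultrafilter_onD:
  assumes "ultrafilter_on S W"
  shows "S \<in> W" "{} \<notin> W" "A \<in> W \<Longrightarrow> A \<subseteq> S" "A \<in> W \<Longrightarrow> B \<in> W \<Longrightarrow> A \<inter> B \<in> W"
    "A \<in> W \<Longrightarrow> A \<subseteq> B \<Longrightarrow> B \<subseteq> S \<Longrightarrow> B \<in> W" "A \<subseteq> S \<Longrightarrow> A \<notin> W \<Longrightarrow> S - A \<in> W"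
  using assms unfolding ultrafilter_on_def by blast+

text \<open>If no block were in the ultrafilter, finitely many complements could be intersected down
  to the empty set; two distinct blocks in it would be disjoint members.\<close>

lemma ultrafilter_partition:
  assumes "ultrafilter_on S W" "finite P" "partition_on S P"
  shows "\<exists>!A. A \<in> P \<and> A \<in> W"
proof -
  note uf = ultrafilter_onD[OF assms(1)]
  \<comment> \<open>Generalised from \<open>P\<close> to families whose union lies in
    \<open>W\<close>, so that the induction can discard a block outside \<open>W\<close> and keep
    this property.\<close>
  have "\<exists>A\<in>Q. A \<in> W" if "finite Q" "\<Union>Q \<in> W" "\<Union>Q \<subseteq> S" for Q
    using that
  proof (induction Q)
    case empty
    then show ?case using uf(2) by simp
  next
    case (insert A Q)
    show ?case
    proof (cases "A \<in> W")
      case False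
      then have "S - A \<in> W" using insert.prems uf(6) by simp
      then have "(S - A) \<inter> \<Union>(insert A Q) \<in> W" using insert.prems uf(4) by blast
      moreover have "(S - A) \<inter> \<Union>(insert A Q) \<subseteq> \<Union>Q" by blast
      moreover have Q: "\<Union>Q \<subseteq> S" using insert.prems(2) by blast
      ultimately have "\<Union>Q \<in> W" by (rule uf(5))
      then show ?thesis using insert.IH[OF _ Q] by blast
    qed auto
  qed
  moreover have "\<Union>P = S" "S \<in> W" using assms(3) uf(1) by (auto simp: partition_on_def)
  ultimately obtain A where A: "A \<in> P" "A \<in> W" using assms(2) by blast
  have "B = A" if "B \<in> P" "B \<in> W" for B
  proof (rule ccontr)
    assume "B \<noteq> A"
    then have "A \<inter> B = {}" using A that assms(3) by (auto simp: partition_on_def disjoint_def)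
    then show False using A that uf(2,4) by metis
  qed
  then show ?thesis using A by blast
qed

lemma tpoint_set_eqI:
  assumes "\<And>v. Inl (Vertex v) \<in> A \<longleftrightarrow> Inl (Vertex v) \<in> B"
    "\<And>e t. Inl (Inner e t) \<in> A \<longleftrightarrow> Inl (Inner e t) \<in> B" "\<And>U. Inr U \<in> A \<longleftrightarrow> Inr U \<in> B"
  shows "A = (B :: (('v, 'e) cpoint + 'c) set)"
proof (rule set_eqI)
  fix z show "z \<in> A \<longleftrightarrow> z \<in> B"
  proof (cases z)
    case (Inl w)
    then show ?thesis using assms(1,2) by (cases w) auto
  qed (use assms(3) in auto)
qed

section \<open>Components and tangles\<close>

locale sgraph =
  fixes V :: "'a set" and E :: "'a set set"
  assumes simple: "simple_graph V E"
begin

lemma edgeE: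
  assumes "e \<in> E"
  obtains u v where "u \<in> V" "v \<in> V" "u \<noteq> v" "e = {u, v}"
  using assms simple unfolding simple_graph_def by blast

lemma comps_subset: "C \<in> comps V E X \<Longrightarrow> C \<subseteq> V - X"
  using Union_comps[of V E X] by blast

lemma comps_nonempty: "C \<in> comps V E X \<Longrightarrow> C \<noteq> {}"
  using comps_partition[of V X E] by (auto simp: partition_on_def)

lemma comps_unique:
  assumes "C \<in> comps V E X" "D \<in> comps V E X" "x \<in> C" "x \<in> D"
  shows "C = D"
  using assms comps_partition[of V X E] by (auto simp: partition_on_def disjoint_def)

lemma mem_Union_comps:
  assumes "\<C> \<subseteq> comps V E X" "C \<in> comps V E X" "x \<in> C" "x \<in> \<Union>\<C>"
  shows "C \<in> \<C>"
  using assms comps_unique by (metis UnionE subsetD)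

lemma comps_edge:
  assumes "{a, b} \<in> E" "C \<in> comps V E X" "a \<in> C" "b \<in> V - X"
  shows "b \<in> C"
proof -
  obtain x where x: "x \<in> V - X" "C = connected_in_minus V E X `` {x}"
    using assms(2) unfolding comps_def by (auto elim: quotientE)
  have a: "a \<in> V - X" using comps_subset assms by blast
  let ?r = "{(a, b). a \<in> V - X \<and> b \<in> V - X \<and> {a, b} \<in> E}"
  have "(x, a) \<in> ?r\<^sup>*" using x assms(3) by (auto simp: connected_in_minus_def)
  moreover have "(a, b) \<in> ?r" using a assms by auto
  ultimately have "(x, b) \<in> ?r\<^sup>*" by (rule rtrancl_into_rtrancl)
  then show ?thesis using x assms(4) by (auto simp: connected_in_minus_def)
qed

text \<open>A walk that avoids \<open>Y\<close> also avoids \<open>X\<close>, so enlarging the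
  deleted set only splits components. The component \<open>D\<close> is the image of
  \<open>C\<close> under phi_{Y,X}.\<close>

lemma comps_refine:
  assumes "X \<subseteq> Y" "C \<in> comps V E Y"
  obtains D where "D \<in> comps V E X" "C \<subseteq> D"
proof -
  obtain x where x: "x \<in> V - Y" "C = connected_in_minus V E Y `` {x}"
    using assms(2) unfolding comps_def by (auto elim: quotientE)
  have "{(a, b). a \<in> V - Y \<and> b \<in> V - Y \<and> {a, b} \<in> E}\<^sup>*
      \<subseteq> {(a, b). a \<in> V - X \<and> b \<in> V - X \<and> {a, b} \<in> E}\<^sup>*"
    using assms(1) by (intro rtrancl_mono) auto
  then have "connected_in_minus V E Y \<subseteq> connected_in_minus V E X"
    using assms(1) unfolding connected_in_minus_def by blast
  then have "C \<subseteq> connected_in_minus V E X `` {x}" using x by blast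
  moreover have "connected_in_minus V E X `` {x} \<in> comps V E X"
    using x assms(1) unfolding comps_def by (intro quotientI) auto
  ultimately show ?thesis using that by blast
qed

lemma comp_map_eq:
  assumes "C' \<in> comps V E Y" "C \<in> comps V E X" "C' \<subseteq> C"
  shows "comp_map V E X C' = C"
  unfolding comp_map_def
proof (rule the_equality)
  fix D assume "D \<in> comps V E X \<and> C' \<subseteq> D"
  then show "D = C" using assms comps_nonempty[OF assms(1)] comps_unique by (metis subsetD ex_in_conv)
qed (use assms in simp)

text \<open>For a family \<open>\<C>\<close> of components of G - X and X \<subseteq> Y, the set
  \<open>comps_in Y (\<Union>\<C>)\<close> is the preimage of \<open>\<C>\<close> under
  phi_{Y,X}.\<close>

definition comps_in :: "'a set \<Rightarrow> 'a set \<Rightarrow> 'a set set" where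
  "comps_in X A = {C \<in> comps V E X. C \<subseteq> A}"

text \<open>The usual pushforward of an ultrafilter: the image of a family lies in
  \<open>\<C>\<close> iff the family lies in the preimage of \<open>\<C>\<close>, and
  \<open>W\<close> is closed upwards, so the preimage can serve as the witness.\<close>

lemma ultrafilter_map_eq:
  assumes "X \<subseteq> Y" "ultrafilter_on (comps V E Y) W"
  shows "ultrafilter_map V E X W = {\<C>. \<C> \<subseteq> comps V E X \<and> comps_in Y (\<Union>\<C>) \<in> W}"
proof -
  have img: "comp_map V E X ` \<C>' \<subseteq> \<C> \<longleftrightarrow> \<C>' \<subseteq> comps_in Y (\<Union>\<C>)"
    if "\<C> \<subseteq> comps V E X" "\<C>' \<subseteq> comps V E Y" for \<C> \<C>'
  proof -
    have "comp_map V E X C' \<in> \<C> \<longleftrightarrow> C' \<subseteq> \<Union>\<C>" if C': "C' \<in> \<C>'" for C'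
    proof -
      have c: "C' \<in> comps V E Y" using C' \<open>\<C>' \<subseteq> _\<close> by blast
      obtain D where D: "D \<in> comps V E X" "C' \<subseteq> D" using comps_refine[OF assms(1) c] .
      obtain x where x: "x \<in> C'" using comps_nonempty[OF c] by blast
      show ?thesis
        unfolding comp_map_eq[OF c D]
        using D x mem_Union_comps[OF \<open>\<C> \<subseteq> comps V E X\<close> D(1), of x] by blast
    qed
    then show ?thesis using that(2) unfolding comps_in_def image_subset_iff by blast
  qed
  have W: "W \<subseteq> Pow (comps V E Y)"
    and up: "\<And>A B. A \<in> W \<Longrightarrow> A \<subseteq> B \<Longrightarrow> B \<subseteq> comps V E Y \<Longrightarrow> B \<in> W"
    using assms(2) unfolding ultrafilter_on_def by blast+
  have "(\<exists>\<C>'\<in>W. comp_map V E X ` \<C>' \<subseteq> \<C>) \<longleftrightarrow> comps_in Y (\<Union>\<C>) \<in> W"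
    if "\<C> \<subseteq> comps V E X" for \<C>
  proof -
    have "comps_in Y (\<Union>\<C>) \<subseteq> comps V E Y" by (auto simp: comps_in_def)
    then show ?thesis using img[OF that] W up by (meson PowD subsetD subset_refl)
  qed
  then show ?thesis unfolding ultrafilter_map_def by blast
qed

lemma tangle_ultrafilter:
  assumes "U \<in> ultrafilter_tangles V E" "X \<in> finite_vertex_sets V"
  shows "ultrafilter_on (comps V E X) (U X)"
  using assms unfolding ultrafilter_tangles_def by auto

lemma tangle_iff:
  assumes "U \<in> ultrafilter_tangles V E" "X \<in> finite_vertex_sets V" "Y \<in> finite_vertex_sets V"
    "X \<subseteq> Y" "\<C> \<subseteq> comps V E X"
  shows "\<C> \<in> U X \<longleftrightarrow> comps_in Y (\<Union>\<C>) \<in> U Y"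
proof -
  have "U X = ultrafilter_map V E X (U Y)"
    using assms unfolding ultrafilter_tangles_def by auto
  then show ?thesis
    using ultrafilter_map_eq[OF assms(4) tangle_ultrafilter[OF assms(1,3)]] assms(5) by simp
qed

section \<open>The inverse system\<close>

lemma index_setD:
  assumes "\<gamma> \<in> index_set V E"
  shows "fst \<gamma> \<in> finite_vertex_sets V" "fst \<gamma> \<subseteq> V" "finite (snd \<gamma>)"
    "partition_on (comps V E (fst \<gamma>)) (snd \<gamma>)"
  using assms by (auto simp: index_set_def finite_vertex_sets_def)

lemma index_block_subset:
  assumes "\<gamma> \<in> index_set V E" "\<C> \<in> snd \<gamma>"
  shows "\<C> \<subseteq> comps V E (fst \<gamma>)"
  using index_setD(4)[OF assms(1)] assms(2) by (auto simp: partition_on_def)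

lemma dummy_subset:
  assumes "\<gamma> \<in> index_set V E" "p \<in> dummies \<gamma>"
  shows "p \<subseteq> V - fst \<gamma>"
  using assms index_block_subset comps_subset unfolding dummies_def by blast

lemma vpart_unique:
  assumes "\<gamma> \<in> index_set V E" "p \<in> vpart \<gamma>" "q \<in> vpart \<gamma>" "x \<in> p" "x \<in> q"
  shows "p = q"
  using vpart_partition[OF assms(1)] assms(2-) by (auto simp: partition_on_def disjoint_def)

lemma vpart_exists:
  assumes "\<gamma> \<in> index_set V E" "v \<in> V"
  obtains p where "p \<in> vpart \<gamma>" "v \<in> p"
  using vpart_partition[OF assms(1)] assms(2) by (auto simp: partition_on_def)

lemma vpart_nonempty:
  assumes "\<gamma> \<in> index_set V E" "p \<in> vpart \<gamma>"
  shows "p \<noteq> {}"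
  using vpart_partition[OF assms(1)] assms(2) by (auto simp: partition_on_def)

lemma dummies_vpart: "p \<in> dummies \<gamma> \<Longrightarrow> p \<in> vpart \<gamma>"
  by (simp add: vpart_def)

lemma vpart_the:
  assumes "\<gamma> \<in> index_set V E" "p \<in> vpart \<gamma>" "q \<subseteq> p" "q \<noteq> {}"
  shows "(THE p. p \<in> vpart \<gamma> \<and> q \<subseteq> p) = p"
proof (rule the_equality)
  fix r assume "r \<in> vpart \<gamma> \<and> q \<subseteq> r"
  then show "r = p" using assms vpart_unique[of \<gamma> r p] by blast
qed (use assms in simp)

lemma dummies_the:
  assumes "\<gamma> \<in> index_set V E" "p \<in> dummies \<gamma>" "e \<subseteq> p" "e \<noteq> {}"
  shows "(THE p. p \<in> dummies \<gamma> \<and> e \<subseteq> p) = p"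
proof (rule the_equality)
  fix r assume "r \<in> dummies \<gamma> \<and> e \<subseteq> r"
  then show "r = p" using assms vpart_unique[of \<gamma> r p] dummies_vpart by blast
qed (use assms in simp)

lemma quot_edges_subset: "quot_edges E \<gamma> \<subseteq> E"
  by (auto simp: quot_edges_def edges_between_def)

lemma quot_edgesI:
  assumes "\<gamma> \<in> index_set V E" "{u, v} \<in> E" "p \<in> vpart \<gamma>" "u \<in> p" "v \<in> V" "v \<notin> p"
  shows "{u, v} \<in> quot_edges E \<gamma>"
proof -
  obtain q where "q \<in> vpart \<gamma>" "v \<in> q" using vpart_exists[OF assms(1,5)] .
  then show ?thesis using assms unfolding quot_edges_def edges_between_def by blast
qed

lemma quot_edge_not_subset:
  assumes "\<gamma> \<in> index_set V E" "e \<in> quot_edges E \<gamma>" "p \<in> vpart \<gamma>"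
  shows "\<not> e \<subseteq> p"
proof
  assume "e \<subseteq> p"
  moreover obtain q r u v where "q \<in> vpart \<gamma>" "r \<in> vpart \<gamma>" "r \<noteq> q" "u \<in> q" "v \<in> r" "e = {u, v}"
    using assms(2) unfolding quot_edges_def edges_between_def by blast
  ultimately show False using vpart_unique[OF assms(1) assms(3)] by blast
qed

text \<open>An edge has two distinct ends, so a class containing both cannot be a singleton and must
  be a dummy.\<close>

lemma edge_cases:
  assumes "\<gamma> \<in> index_set V E" "e \<in> E"
  obtains "e \<in> quot_edges E \<gamma>" | p where "p \<in> dummies \<gamma>" "e \<subseteq> p" "e \<notin> quot_edges E \<gamma>"
proof -
  obtain u v where uv: "u \<in> V" "v \<in> V" "u \<noteq> v" "e = {u, v}" using edgeE[OF assms(2)] .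
  obtain p where p: "p \<in> vpart \<gamma>" "u \<in> p" using vpart_exists[OF assms(1) uv(1)] .
  show ?thesis
  proof (cases "v \<in> p")
    case True
    then have "p \<in> dummies \<gamma>" using p uv(3) by (auto simp: vpart_def)
    moreover have "e \<notin> quot_edges E \<gamma>"
      using quot_edge_not_subset[OF assms(1) _ p(1)] True p uv by blast
    ultimately show ?thesis using that True p uv by blast
  next
    case False
    then show ?thesis using quot_edgesI[OF assms(1)] assms(2) p uv that by blast
  qed
qed

text \<open>The class of \<open>x\<close> is \<open>{x}\<close>, which omits the other end. Hence no
  edge is lost at \<open>x\<close>, and stars at \<open>x\<close> agree in G and in the
  quotient.\<close>

lemma edge_at_vertex_quot:
  assumes "\<gamma> \<in> index_set V E" "e \<in> E" "x \<in> e" "x \<in> fst \<gamma>"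
  shows "e \<in> quot_edges E \<gamma>"
  using edge_cases[OF assms(1,2)] dummy_subset[OF assms(1)] assms(3,4) by blast

text \<open>A dummy is a union of components of G - X, so an edge leaving it ends in X. In
  particular two dummies are never adjacent, which is why dummy neighbourhoods need only mention
  edges to X.\<close>

lemma edge_cases_dummy:
  assumes "\<gamma> \<in> index_set V E" "e \<in> E" "p \<in> dummies \<gamma>" "u \<in> e" "u \<in> p"
  obtains "e \<subseteq> p" "e \<notin> quot_edges E \<gamma>"
  | x where "x \<in> fst \<gamma>" "e = {x, u}" "x \<noteq> u" "e \<in> edges_between E (fst \<gamma>) p"
proof -
  obtain a where a: "a \<in> V" "a \<noteq> u" "e = {a, u}"
    using edgeE[OF assms(2)] assms(4) by (metis doubleton_eq_iff insertE singletonD)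
  obtain \<C> where \<C>: "\<C> \<in> snd \<gamma>" "p = \<Union>\<C>" using assms(3) by (auto simp: dummies_def)
  show ?thesis
  proof (cases "a \<in> fst \<gamma>")
    case True
    then show ?thesis using that(2) a assms(2,5) by (auto simp: edges_between_def)
  next
    case False
    obtain C where C: "C \<in> \<C>" "u \<in> C" using \<C> assms(5) by blast
    then have "a \<in> C"
      using comps_edge[of u a C "fst \<gamma>"] index_block_subset[OF assms(1) \<C>(1)] a False assms(2)
      by (auto simp: insert_commute)
    then have "e \<subseteq> p" using C \<C> a by blast
    then show ?thesis using that(1) quot_edge_not_subset[OF assms(1)] dummies_vpart[OF assms(3)] by blast
  qed
qed

lemma edges_between_quot:
  assumes "\<gamma> \<in> index_set V E" "e \<in> edges_between E (fst \<gamma>) p"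
  shows "e \<in> quot_edges E \<gamma>"
proof -
  obtain x where "x \<in> fst \<gamma>" "x \<in> e" "e \<in> E" using assms(2) by (auto simp: edges_between_def)
  then show ?thesis using edge_at_vertex_quot[OF assms(1)] by blast
qed

text \<open>Components are nonempty and disjoint, so a family of them can be recovered from its
  union. This makes blocks and dummy vertices correspond one to one.\<close>

lemma Union_comps_mono_iff:
  assumes "\<C> \<subseteq> comps V E X" "\<D> \<subseteq> comps V E X"
  shows "\<Union>\<C> \<subseteq> \<Union>\<D> \<longleftrightarrow> \<C> \<subseteq> \<D>"
proof
  assume *: "\<Union>\<C> \<subseteq> \<Union>\<D>"
  show "\<C> \<subseteq> \<D>"
  proof
    fix C assume C: "C \<in> \<C>"
    then have c: "C \<in> comps V E X" using assms(1) by blast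
    obtain x where "x \<in> C" using comps_nonempty[OF c] by blast
    then show "C \<in> \<D>" using mem_Union_comps[OF assms(2) c] * C by blast
  qed
qed blast

lemma index_le_vpart:
  assumes "index_le V \<gamma> \<delta>" "q \<in> vpart \<delta>"
  obtains p where "p \<in> vpart \<gamma>" "q \<subseteq> p"
  using assms unfolding index_le_def refines_def by blast

lemma index_le_dummies:
  assumes "\<gamma> \<in> index_set V E" "\<delta> \<in> index_set V E" "index_le V \<gamma> \<delta>" "q \<in> dummies \<delta>"
  obtains p where "p \<in> dummies \<gamma>" "q \<subseteq> p"
proof -
  obtain p where p: "p \<in> vpart \<gamma>" "q \<subseteq> p"
    using index_le_vpart[OF assms(3) dummies_vpart[OF assms(4)]] .
  have "q \<noteq> {}" "q \<inter> fst \<delta> = {}"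
    using vpart_nonempty[OF assms(2) dummies_vpart[OF assms(4)]] dummy_subset[OF assms(2,4)] by auto
  moreover have "fst \<gamma> \<subseteq> fst \<delta>" using assms(3) by (simp add: index_le_def)
  ultimately have "p \<in> dummies \<gamma>" using p unfolding vpart_def by blast
  then show ?thesis using p that by blast
qed

text \<open>The upper bound is the common refinement of the two partitions, pulled back to the
  components of G - Z. Recording its vertex set exactly allows partitions over one fixed set to be
  refined without enlarging that set.\<close>

lemma index_directed:
  assumes "\<gamma> \<in> index_set V E" "\<delta> \<in> index_set V E"
  obtains \<epsilon> where "\<epsilon> \<in> index_set V E" "fst \<epsilon> = fst \<gamma> \<union> fst \<delta>" "index_le V \<gamma> \<epsilon>" "index_le V \<delta> \<epsilon>"
proof -
  define Z where "Z = fst \<gamma> \<union> fst \<delta>"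
  define B where "B = (\<lambda>(\<C>, \<D>). comps_in Z (\<Union>\<C> \<inter> \<Union>\<D>))"
  \<comment> \<open>Two blocks may have no component of G - Z in common, and a partition has no
    empty block.\<close>
  define R where "R = B ` (snd \<gamma> \<times> snd \<delta>) - {{}}"
  have block: "\<exists>\<C>\<in>snd \<beta>. C \<subseteq> \<Union>\<C>" if \<beta>: "\<beta> \<in> index_set V E" "fst \<beta> \<subseteq> Z" "C \<in> comps V E Z" for C \<beta>
  proof -
    obtain D where "D \<in> comps V E (fst \<beta>)" "C \<subseteq> D" using comps_refine[OF \<beta>(2,3)] .
    moreover have "\<Union>(snd \<beta>) = comps V E (fst \<beta>)"
      using index_setD(4)[OF \<beta>(1)] by (simp add: partition_on_def)
    ultimately show ?thesis by blast
  qed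
  have uniq: "\<C> = \<C>'" if "\<beta> \<in> index_set V E" "\<C> \<in> snd \<beta>" "\<C>' \<in> snd \<beta>" "x \<in> \<Union>\<C>" "x \<in> \<Union>\<C>'" for \<C> \<C>' \<beta> x
  proof -
    have "\<Union>\<C> \<in> vpart \<beta>" "\<Union>\<C>' \<in> vpart \<beta>" using that by (auto simp: vpart_def dummies_def)
    then have "\<Union>\<C> = \<Union>\<C>'" using vpart_unique[OF that(1)] that(4,5) by blast
    then show ?thesis
      using Union_comps_mono_iff index_block_subset[OF that(1)] that(2,3) by (metis subset_antisym order_refl)
  qed
  have part: "partition_on (comps V E Z) R"
  proof (rule partition_onI)
    show "\<Union>R = comps V E Z"
    proof
      show "\<Union>R \<subseteq> comps V E Z" by (auto simp: R_def B_def comps_in_def)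
      show "comps V E Z \<subseteq> \<Union>R"
      proof
        fix C assume C: "C \<in> comps V E Z"
        obtain \<C> \<D> where "\<C> \<in> snd \<gamma>" "\<D> \<in> snd \<delta>" "C \<subseteq> \<Union>\<C>" "C \<subseteq> \<Union>\<D>"
          using block[OF assms(1) _ C] block[OF assms(2) _ C] by (auto simp: Z_def)
        moreover from this have "C \<in> B (\<C>, \<D>)" using C by (simp add: B_def comps_in_def)
        ultimately show "C \<in> \<Union>R" unfolding R_def by blast
      qed
    qed
  next
    fix r r' assume r: "r \<in> R" "r' \<in> R" "r \<noteq> r'"
    show "disjnt r r'"
    proof (rule ccontr)
      assume "\<not> disjnt r r'"
      then obtain C where C: "C \<in> r" "C \<in> r'" by (auto simp: disjnt_def)
      obtain \<C> \<D> \<C>' \<D>' where D: "r = B (\<C>, \<D>)" "r' = B (\<C>', \<D>')" "\<C> \<in> snd \<gamma>" "\<C>' \<in> snd \<gamma>"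
        "\<D> \<in> snd \<delta>" "\<D>' \<in> snd \<delta>" using r by (auto simp: R_def)
      have "C \<in> comps V E Z" using C(1) D(1) by (auto simp: B_def comps_in_def)
      then obtain x where "x \<in> C" using comps_nonempty by blast
      then have "x \<in> \<Union>\<C> \<inter> \<Union>\<D>" "x \<in> \<Union>\<C>' \<inter> \<Union>\<D>'" using C D(1,2) by (auto simp: B_def comps_in_def)
      then have "\<C> = \<C>'" "\<D> = \<D>'" using D uniq[OF assms(1)] uniq[OF assms(2)] by blast+
      then show False using r D by simp
    qed
  next
    show "{} \<notin> R" by (simp add: R_def)
  qed
  have fin: "finite R" using index_setD(3)[OF assms(1)] index_setD(3)[OF assms(2)] by (simp add: R_def)
  have "Z \<in> finite_vertex_sets V"
    using index_setD(1)[OF assms(1)] index_setD(1)[OF assms(2)] by (simp add: Z_def finite_vertex_sets_def)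
  then have \<epsilon>: "(Z, R) \<in> index_set V E" using fin part by (simp add: index_set_def)
  have le: "index_le V \<beta> (Z, R)"
    if \<beta>: "\<beta> \<in> index_set V E" "fst \<beta> \<subseteq> Z" "\<And>r. r \<in> R \<Longrightarrow> \<exists>\<C>\<in>snd \<beta>. \<Union>r \<subseteq> \<Union>\<C>" for \<beta>
  proof -
    have "\<exists>p\<in>vpart \<beta>. q \<subseteq> p" if q: "q \<in> vpart (Z, R)" for q
    proof -
      from q consider z where "z \<in> Z" "q = {z}" | r where "r \<in> R" "q = \<Union>r"
        by (auto simp: vpart_def dummies_def)
      then show ?thesis
      proof cases
        case 1
        then have "z \<in> V" using index_setD(2)[OF \<epsilon>] by auto
        then obtain p where "p \<in> vpart \<beta>" "z \<in> p" using vpart_exists[OF \<beta>(1)] by blast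
        then show ?thesis using 1 by blast
      next
        case 2
        then obtain \<C> where "\<C> \<in> snd \<beta>" "q \<subseteq> \<Union>\<C>" using \<beta>(3)[OF 2(1)] by auto
        moreover from this have "\<Union>\<C> \<in> vpart \<beta>" by (simp add: vpart_def dummies_def)
        ultimately show ?thesis by (intro bexI)
      qed
    qed
    then show ?thesis
      using \<beta> vpart_partition[OF \<epsilon>] vpart_partition[OF \<beta>(1)] by (simp add: index_le_def refines_def)
  qed
  have sub: "\<exists>\<C>\<in>snd \<gamma>. \<exists>\<D>\<in>snd \<delta>. \<Union>r \<subseteq> \<Union>\<C> \<and> \<Union>r \<subseteq> \<Union>\<D>" if rR: "r \<in> R" for r
  proof -
    obtain \<C> \<D> where "\<C> \<in> snd \<gamma>" "\<D> \<in> snd \<delta>" and r: "r = B (\<C>, \<D>)" using rR by (auto simp: R_def)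
    moreover have "\<Union>r \<subseteq> \<Union>\<C> \<inter> \<Union>\<D>" unfolding r B_def comps_in_def by auto
    ultimately show ?thesis by (metis le_inf_iff)
  qed
  have "index_le V \<gamma> (Z, R)"
  proof (rule le[OF assms(1)])
    show "\<exists>\<C>\<in>snd \<gamma>. \<Union>r \<subseteq> \<Union>\<C>" if "r \<in> R" for r using sub[OF that] by metis
  qed (simp add: Z_def)
  moreover have "index_le V \<delta> (Z, R)"
  proof (rule le[OF assms(2)])
    show "\<exists>\<D>\<in>snd \<delta>. \<Union>r \<subseteq> \<Union>\<D>" if "r \<in> R" for r using sub[OF that] by metis
  qed (simp add: Z_def)
  ultimately show ?thesis using that[OF \<epsilon>] by (simp add: Z_def)
qed

section \<open>Values of the bonding maps\<close>

lemma bonding_map_Vertex: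
  assumes "\<gamma> \<in> index_set V E" "p \<in> vpart \<gamma>" "q \<subseteq> p" "q \<noteq> {}"
  shows "bonding_map E \<delta> \<gamma> (Vertex q) = Vertex p"
  using vpart_the[OF assms] by (simp add: bonding_map_def)

lemma bonding_map_Inner:
  "e \<in> quot_edges E \<gamma> \<Longrightarrow> bonding_map E \<delta> \<gamma> (Inner e t) = Inner e t"
  by (simp add: bonding_map_def)

lemma bonding_map_contracted:
  assumes "\<gamma> \<in> index_set V E" "e \<in> E" "p \<in> dummies \<gamma>" "e \<subseteq> p"
  shows "bonding_map E \<delta> \<gamma> (Inner e t) = Vertex p"
proof -
  have "e \<notin> quot_edges E \<gamma>" "e \<noteq> {}"
    using quot_edge_not_subset[OF assms(1) _ dummies_vpart[OF assms(3)]] assms(2,4) edgeE by blast+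
  then show ?thesis using dummies_the[OF assms(1,3,4)] by (simp add: bonding_map_def)
qed

section \<open>The projections and their bijectivity\<close>

text \<open>On points of G this is the formula of \<open>bonding_map\<close> with a vertex read as
  its singleton, as if G were an index above all others; facts about contracted edges therefore
  carry over.\<close>

definition proj :: "'a gidx \<Rightarrow> 'a tpoint \<Rightarrow> ('a set, 'a set) cpoint" where
  "proj \<gamma> z = (case z of
     Inl (Vertex v) \<Rightarrow> Vertex (THE p. p \<in> vpart \<gamma> \<and> {v} \<subseteq> p)
   | Inl (Inner e t) \<Rightarrow>
       if e \<in> quot_edges E \<gamma> then Inner e t else Vertex (THE p. p \<in> dummies \<gamma> \<and> e \<subseteq> p)
   | Inr U \<Rightarrow> Vertex (\<Union>(THE \<C>. \<C> \<in> snd \<gamma> \<and> \<C> \<in> U (fst \<gamma>))))"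

lemma proj_Vertex:
  assumes "\<gamma> \<in> index_set V E" "p \<in> vpart \<gamma>" "v \<in> p"
  shows "proj \<gamma> (Inl (Vertex v)) = Vertex p"
  using vpart_the[OF assms(1,2), of "{v}"] assms(3) by (simp add: proj_def)

lemma proj_Inner: "e \<in> quot_edges E \<gamma> \<Longrightarrow> proj \<gamma> (Inl (Inner e t)) = Inner e t"
  by (simp add: proj_def)

lemma proj_contracted:
  assumes "\<gamma> \<in> index_set V E" "e \<in> E" "p \<in> dummies \<gamma>" "e \<subseteq> p"
  shows "proj \<gamma> (Inl (Inner e t)) = Vertex p"
  using bonding_map_contracted[OF assms] by (simp add: proj_def bonding_map_def)

lemma proj_tangle_exists:
  assumes "\<gamma> \<in> index_set V E" "U \<in> ultrafilter_tangles V E"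
  obtains \<C> where "\<C> \<in> snd \<gamma>" "\<C> \<in> U (fst \<gamma>)" "proj \<gamma> (Inr U) = Vertex (\<Union>\<C>)"
proof -
  have "\<exists>!\<C>. \<C> \<in> snd \<gamma> \<and> \<C> \<in> U (fst \<gamma>)"
    by (rule ultrafilter_partition[OF tangle_ultrafilter[OF assms(2) index_setD(1)[OF assms(1)]]
          index_setD(3,4)[OF assms(1)]])
  from theI'[OF this] show ?thesis by (intro that) (simp_all add: proj_def)
qed

text \<open>Only one block lies in the ultrafilter, and distinct blocks have distinct unions, so the
  dummy vertex determines the block.\<close>

lemma proj_tangle_iff:
  assumes "\<gamma> \<in> index_set V E" "U \<in> ultrafilter_tangles V E" "\<C> \<in> snd \<gamma>"
  shows "proj \<gamma> (Inr U) = Vertex (\<Union>\<C>) \<longleftrightarrow> \<C> \<in> U (fst \<gamma>)"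
proof -
  have ex1: "\<exists>!\<C>. \<C> \<in> snd \<gamma> \<and> \<C> \<in> U (fst \<gamma>)"
    by (rule ultrafilter_partition[OF tangle_ultrafilter[OF assms(2) index_setD(1)[OF assms(1)]]
          index_setD(3,4)[OF assms(1)]])
  obtain \<D> where D: "\<D> \<in> snd \<gamma>" "\<D> \<in> U (fst \<gamma>)" "proj \<gamma> (Inr U) = Vertex (\<Union>\<D>)"
    using proj_tangle_exists[OF assms(1,2)] .
  have "\<Union>\<D> = \<Union>\<C> \<longleftrightarrow> \<D> = \<C>"
    using Union_comps_mono_iff[OF index_block_subset[OF assms(1) assms(3)] index_block_subset[OF assms(1) D(1)]]
      Union_comps_mono_iff[OF index_block_subset[OF assms(1) D(1)] index_block_subset[OF assms(1) assms(3)]]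
    by (metis subset_antisym order_refl)
  then show ?thesis using D ex1 assms(3) by auto
qed

lemma tpoint_cases [consumes 1]:
  assumes "z \<in> topspace (tangle_compactification V E)"
  obtains v where "v \<in> V" "z = Inl (Vertex v)"
  | e t where "e \<in> E" "0 < t" "t < 1" "z = Inl (Inner e t)"
  | U where "U \<in> ultrafilter_tangles V E" "z = Inr U"
  using assms unfolding topspace_tangle_compactification complex_points_def inner_points_def
  by (elim UnE imageE UN_E) auto

lemma proj_in_quot_points:
  assumes "\<gamma> \<in> index_set V E" "z \<in> topspace (tangle_compactification V E)"
  shows "proj \<gamma> z \<in> quot_points E \<gamma>"
  using assms(2)
proof (cases rule: tpoint_cases)
  case (1 v)
  obtain p where "p \<in> vpart \<gamma>" "v \<in> p" using vpart_exists[OF assms(1) 1(1)] .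
  then show ?thesis using proj_Vertex[OF assms(1)] 1 by (simp add: quot_points_def)
next
  case (2 e t)
  show ?thesis using assms(1) 2(1)
  proof (cases rule: edge_cases)
    case 1
    then show ?thesis using 2 by (simp add: proj_Inner quot_points_def)
  next
    case (2 p)
    then show ?thesis using proj_contracted[OF assms(1) \<open>e \<in> E\<close> 2(1,2)] \<open>z = _\<close>
      by (simp add: quot_points_def vpart_def)
  qed
next
  case (3 U)
  obtain \<C> where "\<C> \<in> snd \<gamma>" "\<C> \<in> U (fst \<gamma>)" "proj \<gamma> (Inr U) = Vertex (\<Union>\<C>)"
    using proj_tangle_exists[OF assms(1) 3(1)] .
  then show ?thesis using 3(2) by (simp add: quot_points_def vpart_def dummies_def)
qed

lemma bonding_map_proj:
  assumes "\<gamma> \<in> index_set V E" "\<delta> \<in> index_set V E" "index_le V \<gamma> \<delta>"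
    and "z \<in> topspace (tangle_compactification V E)"
  shows "bonding_map E \<delta> \<gamma> (proj \<delta> z) = proj \<gamma> z"
  using assms(4)
proof (cases rule: tpoint_cases)
  case (1 v)
  obtain q where q: "q \<in> vpart \<delta>" "v \<in> q" using vpart_exists[OF assms(2) 1(1)] .
  obtain p where p: "p \<in> vpart \<gamma>" "q \<subseteq> p" using index_le_vpart[OF assms(3) q(1)] .
  have "proj \<delta> z = Vertex q" "proj \<gamma> z = Vertex p"
    using q p 1 proj_Vertex[OF assms(1)] proj_Vertex[OF assms(2)] by auto
  moreover have "q \<noteq> {}" using q by blast
  ultimately show ?thesis using bonding_map_Vertex[OF assms(1) p] by simp
next
  case z: (2 e t)
  show ?thesis using assms(2) z(1)
  proof (cases rule: edge_cases)
    case 1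
    then show ?thesis using z by (simp add: proj_Inner) (simp add: proj_def bonding_map_def)
  next
    case (2 q)
    obtain p where p: "p \<in> dummies \<gamma>" "q \<subseteq> p" using index_le_dummies[OF assms(1-3) 2(1)] .
    have "proj \<delta> z = Vertex q" using proj_contracted[OF assms(2) z(1) 2(1,2)] z by simp
    moreover have "proj \<gamma> z = Vertex p" using proj_contracted[OF assms(1) z(1) p(1)] 2 p z by auto
    moreover have "q \<noteq> {}" using vpart_nonempty[OF assms(2) dummies_vpart[OF 2(1)]] .
    ultimately show ?thesis using bonding_map_Vertex[OF assms(1) dummies_vpart[OF p(1)] p(2)] by simp
  qed
next
  case (3 U)
  obtain \<D> where D: "\<D> \<in> snd \<delta>" "\<D> \<in> U (fst \<delta>)" "proj \<delta> (Inr U) = Vertex (\<Union>\<D>)"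
    using proj_tangle_exists[OF assms(2) 3(1)] .
  then have d: "\<Union>\<D> \<in> dummies \<delta>" by (simp add: dummies_def)
  obtain p where p: "p \<in> dummies \<gamma>" "\<Union>\<D> \<subseteq> p" using index_le_dummies[OF assms(1-3) d] .
  obtain \<C> where C: "\<C> \<in> snd \<gamma>" "p = \<Union>\<C>" using p(1) by (auto simp: dummies_def)
  \<comment> \<open>The block \<open>\<D>\<close> chosen by \<open>U\<close> at the finer index lies
    in the preimage of \<open>\<C>\<close>. The preimage is then in the ultrafilter, and
    compatibility of \<open>U\<close> moves this back to \<open>\<C>\<close>.\<close>
  have "\<D> \<subseteq> comps_in (fst \<delta>) (\<Union>\<C>)"
    using index_block_subset[OF assms(2) D(1)] p(2) C(2) by (auto simp: comps_in_def)
  then have "comps_in (fst \<delta>) (\<Union>\<C>) \<in> U (fst \<delta>)"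
    using ultrafilter_onD(5)[OF tangle_ultrafilter[OF 3(1) index_setD(1)[OF assms(2)]] D(2)]
    by (simp add: comps_in_def)
  then have "\<C> \<in> U (fst \<gamma>)"
    using tangle_iff[OF 3(1) index_setD(1)[OF assms(1)] index_setD(1)[OF assms(2)] _ index_block_subset[OF assms(1) C(1)]]
      assms(3) by (simp add: index_le_def)
  then have "proj \<gamma> z = Vertex p" using proj_tangle_iff[OF assms(1) 3(1) C(1)] 3(2) C(2) by simp
  then show ?thesis
    using D(3) 3(2) bonding_map_Vertex[OF assms(1) dummies_vpart[OF p(1)] p(2)]
      vpart_nonempty[OF assms(2) dummies_vpart[OF d]] by simp
qed

section \<open>Fibres of the projections\<close>

lemma proj_eq_Inner:
  "proj \<gamma> z = Inner e t \<longleftrightarrow> z = Inl (Inner e t) \<and> e \<in> quot_edges E \<gamma>"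
  by (auto simp: proj_def split: sum.splits cpoint.splits if_splits)

lemma proj_eq_dummy:
  assumes "\<gamma> \<in> index_set V E" "z \<in> topspace (tangle_compactification V E)" "\<C> \<in> snd \<gamma>"
  shows "proj \<gamma> z = Vertex (\<Union>\<C>) \<longleftrightarrow>
    (\<exists>v\<in>\<Union>\<C>. z = Inl (Vertex v)) \<or> (\<exists>e t. e \<subseteq> \<Union>\<C> \<and> z = Inl (Inner e t)) \<or>
    (\<exists>U. z = Inr U \<and> \<C> \<in> U (fst \<gamma>))"
proof -
  have d: "\<Union>\<C> \<in> dummies \<gamma>" using assms(3) by (simp add: dummies_def)
  show ?thesis using assms(2)
  proof (cases rule: tpoint_cases)
    case (1 v)
    obtain p where p: "p \<in> vpart \<gamma>" "v \<in> p" using vpart_exists[OF assms(1) 1(1)] .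
    have "p = \<Union>\<C> \<longleftrightarrow> v \<in> \<Union>\<C>" using p vpart_unique[OF assms(1) p(1) dummies_vpart[OF d] p(2)] by metis
    then show ?thesis using 1(2) proj_Vertex[OF assms(1) p] by simp
  next
    case z: (2 e t)
    show ?thesis using assms(1) z(1)
    proof (cases rule: edge_cases)
      case 1
      then show ?thesis using z quot_edge_not_subset[OF assms(1) 1 dummies_vpart[OF d]] proj_Inner[OF 1]
        by simp
    next
      case (2 p)
      obtain a where a: "a \<in> e" using edgeE[OF z(1)] by blast
      have "p = \<Union>\<C> \<longleftrightarrow> e \<subseteq> \<Union>\<C>"
        using a 2(2) vpart_unique[OF assms(1) dummies_vpart[OF 2(1)] dummies_vpart[OF d], of a]
        by (metis subsetD)
      then show ?thesis using z proj_contracted[OF assms(1) z(1) 2(1,2)] by simp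
    qed
  next
    case (3 U)
    then show ?thesis using proj_tangle_iff[OF assms(1) 3(1) assms(3)] by simp
  qed
qed

text \<open>Dummies avoid X, so neither a contracted edge nor a tangle can reach \<open>{x}\<close>.
  A vertex of G is thus identified by a single coordinate.\<close>

lemma proj_eq_singleton:
  assumes "\<gamma> \<in> index_set V E" "z \<in> topspace (tangle_compactification V E)" "x \<in> fst \<gamma>"
  shows "proj \<gamma> z = Vertex {x} \<longleftrightarrow> z = Inl (Vertex x)"
proof -
  have x: "{x} \<in> vpart \<gamma>" using assms(3) by (simp add: vpart_def)
  have dx: "p \<noteq> {x}" if "p \<in> dummies \<gamma>" for p using dummy_subset[OF assms(1) that] assms(3) by blast
  show ?thesis using assms(2)
  proof (cases rule: tpoint_cases)
    case (1 v)
    obtain p where p: "p \<in> vpart \<gamma>" "v \<in> p" using vpart_exists[OF assms(1) 1(1)] .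
    have "p = {x} \<longleftrightarrow> v = x" using p vpart_unique[OF assms(1) p(1) x p(2)] by blast
    then show ?thesis using 1(2) proj_Vertex[OF assms(1) p] by simp
  next
    case z: (2 e t)
    show ?thesis using assms(1) z(1)
    proof (cases rule: edge_cases)
      case 1
      then show ?thesis using z proj_Inner[OF 1] by simp
    next
      case (2 p)
      then show ?thesis using z dx proj_contracted[OF assms(1) z(1) 2(1,2)] by simp
    qed
  next
    case (3 U)
    obtain \<C> where "\<C> \<in> snd \<gamma>" "\<C> \<in> U (fst \<gamma>)" "proj \<gamma> (Inr U) = Vertex (\<Union>\<C>)"
      using proj_tangle_exists[OF assms(1) 3(1)] .
    then show ?thesis using 3(2) dx[of "\<Union>\<C>"] by (simp add: dummies_def)
  qed
qed

text \<open>Tests one family of components against its complement. For \<open>\<C> = {}\<close> it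
  is the trivial partition, used when only the vertex set matters.\<close>

definition split_index :: "'a set \<Rightarrow> 'a set set \<Rightarrow> 'a gidx" where
  "split_index X \<C> = (X, {\<C>, comps V E X - \<C>} - {{}})"

lemma split_index:
  assumes "X \<in> finite_vertex_sets V" "\<C> \<subseteq> comps V E X"
  shows "split_index X \<C> \<in> index_set V E" "fst (split_index X \<C>) = X"
    "\<C> \<noteq> {} \<Longrightarrow> \<C> \<in> snd (split_index X \<C>)"
proof -
  have "partition_on (comps V E X) ({\<C>, comps V E X - \<C>} - {{}})"
    using assms(2) by (auto simp: partition_on_def disjoint_def)
  then show "split_index X \<C> \<in> index_set V E"
    using assms(1) by (simp add: split_index_def index_set_def)
qed (simp_all add: split_index_def)

section \<open>The projections separate points\<close>

lemma edge_finite_vertex_set: "e \<in> E \<Longrightarrow> e \<in> finite_vertex_sets V"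
  using edgeE[of e] by (auto simp: finite_vertex_sets_def)

lemma proj_inj:
  assumes z: "z \<in> topspace (tangle_compactification V E)"
    and w: "w \<in> topspace (tangle_compactification V E)"
    and eq: "\<And>\<gamma>. \<gamma> \<in> index_set V E \<Longrightarrow> proj \<gamma> z = proj \<gamma> w"
  shows "z = w"
proof -
  \<comment> \<open>This settles every pair in which \<open>a\<close> is a point of G; it is applied
    to \<open>z\<close> and \<open>w\<close> in both orders, leaving only two tangles to
    compare.\<close>
  have G: "a = b"
    if ab: "a \<in> topspace (tangle_compactification V E)" "b \<in> topspace (tangle_compactification V E)"
      "\<And>\<gamma>. \<gamma> \<in> index_set V E \<Longrightarrow> proj \<gamma> a = proj \<gamma> b" "a = Inl q" for a b q
    using ab(1)
  proof (cases rule: tpoint_cases)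
    case (1 v)
    have X: "{v} \<in> finite_vertex_sets V" using 1(1) by (simp add: finite_vertex_sets_def)
    note i = split_index[OF X empty_subsetI]
    have v: "v \<in> fst (split_index {v} {})" using i(2) by simp
    have "proj (split_index {v} {}) a = Vertex {v}" using proj_eq_singleton[OF i(1) ab(1) v] 1(2) by blast
    then show ?thesis using proj_eq_singleton[OF i(1) ab(2) v] ab(3)[OF i(1)] 1(2) by metis
  next
    case (2 e t)
    \<comment> \<open>An edge is a set of two vertices and can itself be the deleted vertex set; at
      such an index it is never contracted.\<close>
    note i = split_index[OF edge_finite_vertex_set[OF 2(1)] empty_subsetI]
    obtain x where "x \<in> e" using edgeE[OF 2(1)] by blast
    then have "e \<in> quot_edges E (split_index e {})" using edge_at_vertex_quot[OF i(1) 2(1)] i(2) by simp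
    then have "proj (split_index e {}) a = Inner e t" using 2(4) by (simp add: proj_Inner)
    then show ?thesis using proj_eq_Inner ab(3)[OF i(1)] 2(4) by metis
  next
    case (3 U)
    then show ?thesis using ab(4) by simp
  qed
  show ?thesis
  proof (cases "\<exists>q. z = Inl q \<or> w = Inl q")
    case True
    then show ?thesis using G[OF z w eq] G[OF w z eq[symmetric]] by blast
  next
    case False
    then obtain U W where UW: "z = Inr U" "w = Inr W" using sum.exhaust_sel by metis
    then have T: "U \<in> ultrafilter_tangles V E" "W \<in> ultrafilter_tangles V E"
      using z w unfolding topspace_tangle_compactification by auto
    have "U X = W X" for X
    proof (cases "X \<in> finite_vertex_sets V")
      case True
      note uf = tangle_ultrafilter[OF T(1) True] tangle_ultrafilter[OF T(2) True]
      have "\<C> \<in> U X \<longleftrightarrow> \<C> \<in> W X" if C: "\<C> \<subseteq> comps V E X" for \<C>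
      proof (cases "\<C> = {}")
        case True
        then show ?thesis using ultrafilter_onD(2)[OF uf(1)] ultrafilter_onD(2)[OF uf(2)] by simp
      next
        case False
        note i = split_index[OF True C]
        have "proj (split_index X \<C>) (Inr U) = proj (split_index X \<C>) (Inr W)" using eq[OF i(1)] UW by blast
        then show ?thesis
          using proj_tangle_iff[OF i(1) T(1) i(3)[OF False]] proj_tangle_iff[OF i(1) T(2) i(3)[OF False]]
            i(2) by metis
      qed
      then show ?thesis using ultrafilter_onD(3)[OF uf(1)] ultrafilter_onD(3)[OF uf(2)] by blast
    next
      case False
      \<comment> \<open>Away from the finite vertex sets both families take the default value of
        extensional functions.\<close>
      then show ?thesis using T unfolding ultrafilter_tangles_def by (auto simp: PiE_def extensional_def)
    qed
    then show ?thesis using UW by auto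
  qed
qed

section \<open>Surjectivity onto the compatible families\<close>

lemma Int_Union_comps:
  assumes "\<C> \<subseteq> comps V E X" "\<D> \<subseteq> comps V E X"
  shows "\<Union>\<C> \<inter> \<Union>\<D> = \<Union>(\<C> \<inter> \<D>)"
proof
  show "\<Union>\<C> \<inter> \<Union>\<D> \<subseteq> \<Union>(\<C> \<inter> \<D>)"
  proof
    fix x assume x: "x \<in> \<Union>\<C> \<inter> \<Union>\<D>"
    then obtain C where C: "C \<in> \<C>" "x \<in> C" by blast
    then have "C \<in> \<D>" using mem_Union_comps[OF assms(2)] assms(1) x by blast
    then show "x \<in> \<Union>(\<C> \<inter> \<D>)" using C by blast
  qed
qed blast

lemma proj_surj_tangle:
  assumes compat: "\<And>\<gamma> \<delta>. \<gamma> \<in> index_set V E \<Longrightarrow> \<delta> \<in> index_set V E \<Longrightarrow> index_le V \<gamma> \<delta> \<Longrightarrow>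
      bonding_map E \<delta> \<gamma> (z \<delta>) = z \<gamma>"
    and dummy: "\<And>\<gamma>. \<gamma> \<in> index_set V E \<Longrightarrow> \<exists>p\<in>dummies \<gamma>. z \<gamma> = Vertex p"
  shows "\<exists>U\<in>ultrafilter_tangles V E. \<forall>\<gamma>\<in>index_set V E. proj \<gamma> (Inr U) = z \<gamma>"
proof -
  have mono: "q \<subseteq> p" if "\<gamma> \<in> index_set V E" "\<delta> \<in> index_set V E" "index_le V \<gamma> \<delta>"
    "z \<gamma> = Vertex p" "z \<delta> = Vertex q" "q \<in> dummies \<delta>" for \<gamma> \<delta> p q
  proof -
    have qn: "q \<noteq> {}" using vpart_nonempty[OF that(2) dummies_vpart[OF that(6)]] .
    obtain r where "r \<in> dummies \<gamma>" "q \<subseteq> r" using index_le_dummies[OF \<open>\<gamma> \<in> _\<close> \<open>\<delta> \<in> _\<close> \<open>index_le V \<gamma> \<delta>\<close> \<open>q \<in> _\<close>] .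
    then show ?thesis
      using bonding_map_Vertex[OF that(1) dummies_vpart _ qn, of r] compat[OF that(1-3)] that(4,5) by simp
  qed
  \<comment> \<open>\<open>N X\<close> is to become the ultrafilter at \<open>X\<close>. Quantifying
    over all partitions with vertex set \<open>X\<close>, and asking only for inclusion of the
    dummy, makes upward closure immediate and gives intersections by common refinement.\<close>
  define N where "N X \<C> \<longleftrightarrow> \<C> \<subseteq> comps V E X \<and>
      (\<exists>\<gamma>\<in>index_set V E. fst \<gamma> = X \<and> (\<exists>p\<in>dummies \<gamma>. z \<gamma> = Vertex p \<and> p \<subseteq> \<Union>\<C>))" for X \<C>
  have N_ne: "\<not> N X {}" for X
  proof
    assume "N X {}"
    then obtain \<gamma> p where "\<gamma> \<in> index_set V E" "p \<in> dummies \<gamma>" "p \<subseteq> {}" unfolding N_def by auto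
    then show False using vpart_nonempty dummies_vpart by blast
  qed
  have N_up: "N X \<D>" if "N X \<C>" "\<C> \<subseteq> \<D>" "\<D> \<subseteq> comps V E X" for X \<C> \<D>
  proof -
    have "\<Union>\<C> \<subseteq> \<Union>\<D>" using that(2) by (rule Union_mono)
    then show ?thesis using that unfolding N_def by (meson order_trans)
  qed
  have N_Int: "N X (\<C> \<inter> \<D>)" if N: "N X \<C>" "N X \<D>" for X \<C> \<D>
  proof -
    obtain \<gamma> p where g: "\<gamma> \<in> index_set V E" "fst \<gamma> = X" "p \<in> dummies \<gamma>" "z \<gamma> = Vertex p" "p \<subseteq> \<Union>\<C>"
      using N(1) unfolding N_def by metis
    obtain \<delta> q where d: "\<delta> \<in> index_set V E" "fst \<delta> = X" "q \<in> dummies \<delta>" "z \<delta> = Vertex q" "q \<subseteq> \<Union>\<D>"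
      using N(2) unfolding N_def by metis
    obtain \<epsilon> where e: "\<epsilon> \<in> index_set V E" "fst \<epsilon> = fst \<gamma> \<union> fst \<delta>" "index_le V \<gamma> \<epsilon>" "index_le V \<delta> \<epsilon>"
      using index_directed[OF g(1) d(1)] .
    obtain r where r: "r \<in> dummies \<epsilon>" "z \<epsilon> = Vertex r" using dummy[OF e(1)] ..
    have "r \<subseteq> p" "r \<subseteq> q" using mono[OF g(1) e(1,3) g(4) r(2,1)] mono[OF d(1) e(1,4) d(4) r(2,1)] .
    then have "r \<subseteq> \<Union>\<C> \<inter> \<Union>\<D>" by (intro le_infI order_trans[OF _ g(5)] order_trans[OF _ d(5)])
    moreover have CD: "\<C> \<subseteq> comps V E X" "\<D> \<subseteq> comps V E X" using N by (simp_all add: N_def)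
    ultimately have r': "r \<subseteq> \<Union>(\<C> \<inter> \<D>)" using Int_Union_comps[OF CD] by simp
    have "fst \<epsilon> = X" using e(2) g(2) d(2) by simp
    then show ?thesis using e(1) r r' CD(1) unfolding N_def
      by (intro conjI bexI[of _ \<epsilon>] bexI[of _ r] le_infI1) simp_all
  qed
  \<comment> \<open>At the two-block index the only possible dummies are the unions of the two
    sides, so the coordinate there chooses a side.\<close>
  have N_ultra: "N X \<C> \<or> N X (comps V E X - \<C>)" if X: "X \<in> finite_vertex_sets V" and C: "\<C> \<subseteq> comps V E X" for X \<C>
  proof -
    note i = split_index[OF X C]
    obtain p where p: "p \<in> dummies (split_index X \<C>)" "z (split_index X \<C>) = Vertex p" using dummy[OF i(1)] ..
    then have "p = \<Union>\<C> \<or> p = \<Union>(comps V E X - \<C>)" by (auto simp: split_index_def dummies_def)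
    then show ?thesis using i(1,2) C p unfolding N_def by (metis Diff_subset order_refl)
  qed
  have uf: "ultrafilter_on (comps V E X) (Collect (N X))" if X: "X \<in> finite_vertex_sets V" for X
  proof -
    have "N X (comps V E X)" using N_ultra[OF X, of "{}"] N_ne by simp
    moreover have "Collect (N X) \<subseteq> Pow (comps V E X)" by (auto simp: N_def)
    ultimately show ?thesis
      unfolding ultrafilter_on_def using N_ne N_Int N_up N_ultra[OF X] by (simp add: Ball_def)
  qed
  have lift: "N Y (comps_in Y (\<Union>\<C>))"
    if Y: "Y \<in> finite_vertex_sets V" "X \<subseteq> Y" and N: "N X \<C>" for X Y \<C>
  proof -
    obtain \<gamma> p where g: "\<gamma> \<in> index_set V E" "fst \<gamma> = X" "p \<in> dummies \<gamma>" "z \<gamma> = Vertex p" "p \<subseteq> \<Union>\<C>"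
      using N unfolding N_def by metis
    \<comment> \<open>The trivial partition over \<open>Y\<close> is brought in to obtain a common
      refinement whose vertex set is exactly \<open>Y\<close>.\<close>
    note i = split_index[OF Y(1) empty_subsetI]
    obtain \<epsilon> where e: "\<epsilon> \<in> index_set V E" "fst \<epsilon> = fst \<gamma> \<union> fst (split_index Y {})" "index_le V \<gamma> \<epsilon>"
      "index_le V (split_index Y {}) \<epsilon>"
      using index_directed[OF g(1) i(1)] .
    have eY: "fst \<epsilon> = Y" using e(2) g(2) i(2) Y(2) by auto
    obtain r where r: "r \<in> dummies \<epsilon>" "z \<epsilon> = Vertex r" using dummy[OF e(1)] ..
    have "r \<subseteq> \<Union>\<C>" using mono[OF g(1) e(1,3) g(4) r(2,1)] g(5) by (rule order_trans)
    moreover obtain \<D> where D: "\<D> \<in> snd \<epsilon>" "r = \<Union>\<D>" using r(1) by (auto simp: dummies_def)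
    ultimately have "\<D> \<subseteq> comps_in Y (\<Union>\<C>)"
      using index_block_subset[OF e(1) D(1)] eY by (auto simp: comps_in_def)
    then have "r \<subseteq> \<Union>(comps_in Y (\<Union>\<C>))" unfolding D(2) by (rule Union_mono)
    moreover have "comps_in Y (\<Union>\<C>) \<subseteq> comps V E Y" by (auto simp: comps_in_def)
    ultimately show ?thesis using e(1) eY r unfolding N_def by metis
  qed
  \<comment> \<open>The converse of \<open>lift\<close> follows formally: if \<open>\<C>\<close>
    failed, its complement would belong to \<open>N X\<close>, and lifting it would give two
    disjoint members of \<open>N Y\<close>.\<close>
  have unlift: "N X \<C>"
    if XY: "X \<in> finite_vertex_sets V" "Y \<in> finite_vertex_sets V" "X \<subseteq> Y" and C: "\<C> \<subseteq> comps V E X"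
      and N: "N Y (comps_in Y (\<Union>\<C>))" for X Y \<C>
  proof (rule ccontr)
    let ?\<D> = "comps V E X - \<C>"
    assume "\<not> N X \<C>"
    then have "N Y (comps_in Y (\<Union>?\<D>))" using N_ultra[OF XY(1) C] lift[OF XY(2,3)] by blast
    then have "N Y (comps_in Y (\<Union>\<C>) \<inter> comps_in Y (\<Union>?\<D>))" using N_Int N by blast
    moreover have "comps_in Y (\<Union>\<C>) \<inter> comps_in Y (\<Union>?\<D>) = {}"
    proof -
      have "\<Union>\<C> \<inter> \<Union>?\<D> = {}" using Int_Union_comps[OF C, of ?\<D>] by auto
      then have "D = {}" if "D \<subseteq> \<Union>\<C>" "D \<subseteq> \<Union>?\<D>" for D using that by (metis le_inf_iff subset_empty)
      moreover have "D \<noteq> {}" if "D \<in> comps_in Y A" for D A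
        using that comps_nonempty unfolding comps_in_def by blast
      moreover have "D \<subseteq> A" if "D \<in> comps_in Y A" for D A using that by (simp add: comps_in_def)
      ultimately show ?thesis by (metis disjoint_iff)
    qed
    ultimately show False using N_ne by simp
  qed
  define U where "U = restrict (\<lambda>X. Collect (N X)) (finite_vertex_sets V)"
  have "ultrafilter_map V E X (U Y) = U X"
    if XY: "X \<in> finite_vertex_sets V" "Y \<in> finite_vertex_sets V" "X \<subseteq> Y" for X Y
  proof -
    have "N Y (comps_in Y (\<Union>\<C>)) \<longleftrightarrow> N X \<C>" if "\<C> \<subseteq> comps V E X" for \<C>
      using lift[OF XY(2,3)] unlift[OF XY that] by blast
    moreover have "\<C> \<subseteq> comps V E X" if "N X \<C>" for \<C> using that by (simp add: N_def)
    ultimately show ?thesis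
      using XY ultrafilter_map_eq[OF XY(3) uf[OF XY(2)]] by (auto simp: U_def)
  qed
  then have UT: "U \<in> ultrafilter_tangles V E"
    unfolding ultrafilter_tangles_def using uf by (auto simp: U_def)
  have "proj \<gamma> (Inr U) = z \<gamma>" if g: "\<gamma> \<in> index_set V E" for \<gamma>
  proof -
    obtain \<C> where C: "\<C> \<in> snd \<gamma>" "z \<gamma> = Vertex (\<Union>\<C>)" using dummy[OF g] by (auto simp: dummies_def)
    then have "\<Union>\<C> \<in> dummies \<gamma>" by (simp add: dummies_def)
    then have "N (fst \<gamma>) \<C>" using C index_block_subset[OF g C(1)] g unfolding N_def by (metis order_refl)
    then have "\<C> \<in> U (fst \<gamma>)" using index_setD(1)[OF g] by (simp add: U_def)
    then show ?thesis using proj_tangle_iff[OF g UT C(1)] C(2) by simp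
  qed
  then show ?thesis using UT by blast
qed

lemma proj_surj:
  assumes compat: "\<And>\<gamma> \<delta>. \<gamma> \<in> index_set V E \<Longrightarrow> \<delta> \<in> index_set V E \<Longrightarrow> index_le V \<gamma> \<delta> \<Longrightarrow>
      bonding_map E \<delta> \<gamma> (z \<delta>) = z \<gamma>"
    and pts: "\<And>\<gamma>. \<gamma> \<in> index_set V E \<Longrightarrow> z \<gamma> \<in> quot_points E \<gamma>"
  shows "\<exists>w\<in>topspace (tangle_compactification V E). \<forall>\<gamma>\<in>index_set V E. proj \<gamma> w = z \<gamma>"
proof -
  \<comment> \<open>By directedness it is enough to know the coordinates above one index: any other
    index has a common upper bound with it, from which the bonding map carries the equality
    down.\<close>
  have gen: ?thesis
    if g: "\<gamma> \<in> index_set V E" and w: "w \<in> topspace (tangle_compactification V E)"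
      and det: "\<And>\<epsilon>. \<epsilon> \<in> index_set V E \<Longrightarrow> index_le V \<gamma> \<epsilon> \<Longrightarrow> z \<epsilon> = proj \<epsilon> w" for \<gamma> w
  proof -
    have "proj \<delta> w = z \<delta>" if d: "\<delta> \<in> index_set V E" for \<delta>
    proof -
      obtain \<epsilon> where e: "\<epsilon> \<in> index_set V E" "fst \<epsilon> = fst \<gamma> \<union> fst \<delta>" "index_le V \<gamma> \<epsilon>" "index_le V \<delta> \<epsilon>"
        using index_directed[OF g d] .
      have "proj \<delta> w = bonding_map E \<epsilon> \<delta> (proj \<epsilon> w)" using bonding_map_proj[OF d e(1,4) w] by simp
      also have "\<dots> = z \<delta>" using det[OF e(1,3)] compat[OF d e(1,4)] by simp
      finally show ?thesis .
    qed
    then show ?thesis using w by blast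
  qed
  consider (inner) \<gamma> e t where "\<gamma> \<in> index_set V E" "z \<gamma> = Inner e t"
    | (single) \<gamma> x where "\<gamma> \<in> index_set V E" "x \<in> fst \<gamma>" "z \<gamma> = Vertex {x}"
    | (dummy) "\<And>\<gamma>. \<gamma> \<in> index_set V E \<Longrightarrow> \<exists>p\<in>dummies \<gamma>. z \<gamma> = Vertex p"
  proof (cases "\<exists>\<gamma>\<in>index_set V E. \<forall>p\<in>dummies \<gamma>. z \<gamma> \<noteq> Vertex p")
    case True
    then obtain \<gamma> where g: "\<gamma> \<in> index_set V E" "\<forall>p\<in>dummies \<gamma>. z \<gamma> \<noteq> Vertex p" by blast
    show ?thesis
    proof (cases "z \<gamma>")
      case (Vertex p)
      then have "p \<in> vpart \<gamma>" using pts[OF g(1)] by (auto simp: quot_points_def)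
      then obtain x where "x \<in> fst \<gamma>" "p = {x}" using g(2) Vertex unfolding vpart_def by blast
      then show ?thesis using single[OF g(1)] Vertex by simp
    next
      case (Inner e t)
      then show ?thesis using inner[OF g(1)] by simp
    qed
  next
    case False
    then show ?thesis using dummy by blast
  qed
  then show ?thesis
  proof cases
    case inner
    have et: "e \<in> E" "0 < t" "t < 1"
      using pts[OF inner(1)] inner(2) quot_edges_subset[of \<gamma>] by (auto simp: quot_points_def)
    show ?thesis
    proof (rule gen[OF inner(1), of "Inl (Inner e t)"])
      show "Inl (Inner e t) \<in> topspace (tangle_compactification V E)"
        using et unfolding topspace_tangle_compactification by (simp add: complex_points_def)
      fix \<epsilon> assume e: "\<epsilon> \<in> index_set V E" "index_le V \<gamma> \<epsilon>"
      have "bonding_map E \<epsilon> \<gamma> (z \<epsilon>) = Inner e t" using compat[OF inner(1) e] inner(2) by simp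
      \<comment> \<open>A bonding map yields an inner point only by keeping that very point.\<close>
      then have ze: "z \<epsilon> = Inner e t" by (auto simp: bonding_map_def split: cpoint.splits if_splits)
      then show "z \<epsilon> = proj \<epsilon> (Inl (Inner e t))"
        using pts[OF e(1)] by (auto simp: quot_points_def proj_def)
    qed
  next
    case single
    have x: "x \<in> V" using single index_setD(2) by blast
    show ?thesis
    proof (rule gen[OF single(1), of "Inl (Vertex x)"])
      show "Inl (Vertex x) \<in> topspace (tangle_compactification V E)"
        using x unfolding topspace_tangle_compactification by (simp add: complex_points_def)
      fix \<epsilon> assume e: "\<epsilon> \<in> index_set V E" "index_le V \<gamma> \<epsilon>"
      have b: "bonding_map E \<epsilon> \<gamma> (z \<epsilon>) = Vertex {x}" using compat[OF single(1) e] single(3) by simp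
      have xe: "x \<in> fst \<epsilon>" using e(2) single(2) by (auto simp: index_le_def)
      \<comment> \<open>Under the bonding map an inner point stays inner or goes to a dummy, which
        is disjoint from \<open>fst \<gamma>\<close>; and a nonempty class inside \<open>{x}\<close>
        is \<open>{x}\<close>. So \<open>Vertex {x}\<close> has no other point above it.\<close>
      have "z \<epsilon> = Vertex {x}"
      proof (cases "z \<epsilon>")
        case (Vertex q)
        then have q: "q \<in> vpart \<epsilon>" using pts[OF e(1)] by (auto simp: quot_points_def)
        have qn: "q \<noteq> {}" by (rule vpart_nonempty[OF e(1) q])
        obtain p where p: "p \<in> vpart \<gamma>" "q \<subseteq> p" using index_le_vpart[OF e(2) q] .
        have "p = {x}" using bonding_map_Vertex[OF single(1) p qn] b Vertex by simp
        then have "q = {x}" using p(2) qn by (simp add: subset_singleton_iff)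
        then show ?thesis using Vertex by simp
      next
        case (Inner e' t)
        then have e': "e' \<in> E" using pts[OF e(1)] quot_edges_subset[of \<epsilon>] by (auto simp: quot_points_def)
        show ?thesis using single(1) e'
        proof (cases rule: edge_cases)
          case 1
          then show ?thesis using b Inner by (simp add: bonding_map_Inner)
        next
          case (2 p)
          then have "p = {x}" using bonding_map_contracted[OF single(1) e' 2(1,2)] b Inner by simp
          then show ?thesis using 2(1) dummy_subset[OF single(1)] single(2) by blast
        qed
      qed
      then show "z \<epsilon> = proj \<epsilon> (Inl (Vertex x))"
        using proj_Vertex[OF e(1), of "{x}" x] xe by (simp add: vpart_def)
    qed
  next
    case dummy
    obtain U where "U \<in> ultrafilter_tangles V E" "\<forall>\<gamma>\<in>index_set V E. proj \<gamma> (Inr U) = z \<gamma>"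
      using proj_surj_tangle[OF compat dummy] by blast
    then show ?thesis unfolding topspace_tangle_compactification by blast
  qed
qed

text \<open>No edge joins two components. Hence the union of the induced subgraphs in
  \<open>tangle_basic\<close> contains every edge with both ends in the union of the family.\<close>

lemma edge_within_component:
  assumes "\<C> \<subseteq> comps V E X" "e \<in> E" "e \<subseteq> \<Union>\<C>"
  shows "\<exists>C\<in>\<C>. e \<subseteq> C"
proof -
  obtain u v where uv: "u \<in> V" "v \<in> V" "u \<noteq> v" "e = {u, v}" using edgeE[OF assms(2)] .
  then obtain C D where C: "C \<in> \<C>" "u \<in> C" "D \<in> \<C>" "v \<in> D" using assms(3) by auto
  have "v \<in> V - X" using comps_subset[of D X] C assms(1) by blast
  then have "v \<in> C" using comps_edge[of u v C X] C assms(1,2) uv(4) by blast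
  then show ?thesis using C uv by auto
qed

lemma tangle_basic_iff:
  assumes "\<C> \<subseteq> comps V E X"
  shows "Inl (Vertex v) \<in> tangle_basic V E X \<C> \<longleftrightarrow> v \<in> \<Union>\<C>"
    "Inl (Inner e t) \<in> tangle_basic V E X \<C> \<longleftrightarrow>
      0 < t \<and> t < 1 \<and> e \<in> E \<and> (e \<subseteq> \<Union>\<C> \<or> e \<in> edges_between E X (\<Union>\<C>))"
    "Inr U \<in> tangle_basic V E X \<C> \<longleftrightarrow> U \<in> ultrafilter_tangles V E \<and> \<C> \<in> U X"
proof -
  have Inl_iff: "Inl w \<in> tangle_basic V E X \<C> \<longleftrightarrow>
      (\<exists>C\<in>\<C>. w \<in> complex_points C {e\<in>E. e \<subseteq> C}) \<or> w \<in> inner_points (edges_between E X (\<Union>\<C>))" for w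
    unfolding tangle_basic_def by auto
  show "Inl (Vertex v) \<in> tangle_basic V E X \<C> \<longleftrightarrow> v \<in> \<Union>\<C>"
    unfolding Inl_iff by auto
  have "(\<exists>C\<in>\<C>. e \<subseteq> C) \<longleftrightarrow> e \<subseteq> \<Union>\<C>" if "e \<in> E"
    using edge_within_component[OF assms that] by blast
  moreover have "e \<in> E" if "e \<in> edges_between E X (\<Union>\<C>)" using that by (simp add: edges_between_def)
  moreover have "Inner e t \<in> complex_points C {e\<in>E. e \<subseteq> C} \<longleftrightarrow> e \<in> E \<and> e \<subseteq> C \<and> 0 < t \<and> t < 1" for C
    by auto
  ultimately show "Inl (Inner e t) \<in> tangle_basic V E X \<C> \<longleftrightarrow>
      0 < t \<and> t < 1 \<and> e \<in> E \<and> (e \<subseteq> \<Union>\<C> \<or> e \<in> edges_between E X (\<Union>\<C>))"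
    unfolding Inl_iff inner_points_iff by meson
  show "Inr U \<in> tangle_basic V E X \<C> \<longleftrightarrow> U \<in> ultrafilter_tangles V E \<and> \<C> \<in> U X"
    unfolding tangle_basic_def by auto
qed

section \<open>Preimages of generating open sets\<close>

text \<open>The part trimmed off in \<open>dummy_nbhds\<close>. The vertex type is left polymorphic
  because the same inner points are removed in G and in the quotient.\<close>

definition removed :: "'a set set \<Rightarrow> 'a set \<Rightarrow> ('a set \<Rightarrow> real) \<Rightarrow> ('v, 'a set) cpoint set" where
  "removed F X j = (\<Union>e\<in>F. \<Union>x\<in>e \<inter> X. at_dist x e ` {0<..j e})"

lemma removed_iff [simp]:
  "Vertex v \<notin> removed F X j"
  "Inner e t \<in> removed F X j \<longleftrightarrow> e \<in> F \<and> (\<exists>x\<in>e \<inter> X. 0 < dist_from x e t \<and> dist_from x e t \<le> j e)"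
  by (auto simp: removed_def)

definition preimage :: "'a gidx \<Rightarrow> ('a set, 'a set) cpoint set \<Rightarrow> 'a tpoint set" where
  "preimage \<gamma> S = {z \<in> topspace (tangle_compactification V E). proj \<gamma> z \<in> S}"

lemma topspace_iff [simp]:
  "Inl (Vertex v) \<in> topspace (tangle_compactification V E) \<longleftrightarrow> v \<in> V"
  "Inl (Inner e t) \<in> topspace (tangle_compactification V E) \<longleftrightarrow> e \<in> E \<and> 0 < t \<and> t < 1"
  "Inr U \<in> topspace (tangle_compactification V E) \<longleftrightarrow> U \<in> ultrafilter_tangles V E"
  unfolding topspace_tangle_compactification by auto

lemma preimage_edge_interval:
  assumes "\<gamma> \<in> index_set V E" "e \<in> quot_edges E \<gamma>" "0 \<le> a" "b \<le> 1"
  shows "preimage \<gamma> (Inner e ` {a<..<b}) = Inl ` Inner e ` {a<..<b}"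
proof
  show "preimage \<gamma> (Inner e ` {a<..<b}) \<subseteq> Inl ` Inner e ` {a<..<b}"
  proof
    fix z assume z: "z \<in> preimage \<gamma> (Inner e ` {a<..<b})"
    then obtain t where t: "t \<in> {a<..<b}" "proj \<gamma> z = Inner e t" unfolding preimage_def by blast
    have "z \<in> topspace (tangle_compactification V E)" using z by (simp add: preimage_def)
    then have "z = Inl (Inner e t)" using proj_eq_Inner t(2) by blast
    then show "z \<in> Inl ` Inner e ` {a<..<b}" using t(1) by blast
  qed
  have "e \<in> E" using assms(2) quot_edges_subset[of \<gamma>] by blast
  then show "Inl ` Inner e ` {a<..<b} \<subseteq> preimage \<gamma> (Inner e ` {a<..<b})"
    using assms(2-) by (auto simp: preimage_def proj_Inner)
qed

text \<open>All edges of G at \<open>x\<close> survive in the quotient and nothing else is mapped to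
  \<open>{x}\<close>, so the star pulls back with the same radii.\<close>

lemma preimage_star:
  assumes g: "\<gamma> \<in> index_set V E" and x: "x \<in> fst \<gamma>" and j: "\<And>e. 0 < j e \<and> j e < (1::real)"
  shows "preimage \<gamma> (insert (Vertex {x}) (\<Union>e\<in>{e\<in>quot_edges E \<gamma>. x \<in> e}. at_dist x e ` {0<..<j e}))
    = Inl ` insert (Vertex x) (\<Union>e\<in>{e\<in>E. x \<in> e}. at_dist x e ` {0<..<j e})"
    (is "preimage \<gamma> ?S = Inl ` ?T")
proof -
  have T: "w \<in> complex_points V E" if "w \<in> ?T" for w
    using that
  proof (cases w)
    case (Inner e t)
    then have "e \<in> E" "0 < dist_from x e t" "dist_from x e t < 1" using that j[of e] by auto
    then show ?thesis using Inner by (auto simp: dist_from_def split: if_splits)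
  qed (use x index_setD(2)[OF g] in auto)
  have q: "e \<in> quot_edges E \<gamma>" if "e \<in> E" "x \<in> e" for e using edge_at_vertex_quot[OF g that x] .
  have "z \<in> preimage \<gamma> ?S \<longleftrightarrow> z \<in> Inl ` ?T" if z: "z \<in> topspace (tangle_compactification V E)" for z
  proof (cases "proj \<gamma> z")
    case (Vertex p)
    then have "z \<in> preimage \<gamma> ?S \<longleftrightarrow> z = Inl (Vertex x)"
      using proj_eq_singleton[OF g z x] z by (auto simp: preimage_def)
    also have "\<dots> \<longleftrightarrow> z \<in> Inl ` ?T"
    proof -
      have "z \<notin> Inl ` ?T" if nz: "z \<noteq> Inl (Vertex x)"
      proof
        assume "z \<in> Inl ` ?T"
        then obtain e t where "z = Inl (Inner e t)" "e \<in> E" "x \<in> e"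
          using nz by (auto simp: at_dist_def)
        then show False using Vertex q[of e] proj_Inner by auto
      qed
      then show ?thesis by blast
    qed
    finally show ?thesis .
  next
    case (Inner e t)
    then have ze: "z = Inl (Inner e t)" "e \<in> quot_edges E \<gamma>" using proj_eq_Inner by auto
    have "e \<in> E" using ze(2) quot_edges_subset[of \<gamma>] by blast
    have "z \<in> preimage \<gamma> ?S \<longleftrightarrow> Inner e t \<in> ?S" using z Inner by (simp add: preimage_def)
    also have "\<dots> \<longleftrightarrow> Inner e t \<in> ?T" using ze(2) \<open>e \<in> E\<close> by simp
    also have "\<dots> \<longleftrightarrow> z \<in> Inl ` ?T" unfolding ze(1) by (simp only: inj_image_mem_iff[OF inj_Inl])
    finally show ?thesis .
  qed
  moreover have "Inl ` ?T \<subseteq> topspace (tangle_compactification V E)"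
    using T unfolding topspace_tangle_compactification by blast
  moreover have "preimage \<gamma> ?S \<subseteq> topspace (tangle_compactification V E)" by (auto simp: preimage_def)
  ultimately show ?thesis by blast
qed

text \<open>Vertices, tangles and contracted edges of the block land on the dummy vertex, while
  edges to X stay where they are. For \<open>F = {}\<close> the preimage is exactly a generator of
  the tangle compactification.\<close>

lemma preimage_dummy:
  assumes g: "\<gamma> \<in> index_set V E" and C: "\<C> \<in> snd \<gamma>" and F: "F \<subseteq> edges_between E (fst \<gamma>) (\<Union>\<C>)"
  shows "preimage \<gamma> (insert (Vertex (\<Union>\<C>)) (inner_points (edges_between E (fst \<gamma>) (\<Union>\<C>))) - removed F (fst \<gamma>) j)
    = tangle_basic V E (fst \<gamma>) \<C> - Inl ` removed F (fst \<gamma>) j"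
    (is "preimage \<gamma> (insert (Vertex ?p) (inner_points ?B) - ?R) = _ - Inl ` ?R'")
proof -
  note sub = index_block_subset[OF g C]
  have d: "?p \<in> dummies \<gamma>" using C by (simp add: dummies_def)
  note pV = dummy_subset[OF g d]
  show ?thesis
  proof (rule tpoint_set_eqI)
    fix v
    have "proj \<gamma> (Inl (Vertex v)) = Vertex ?p \<longleftrightarrow> v \<in> ?p" if "v \<in> V"
      using proj_eq_dummy[OF g _ C, of "Inl (Vertex v)"] that by simp
    moreover have "proj \<gamma> (Inl (Vertex v)) \<notin> inner_points ?B" by (simp add: proj_def)
    moreover have "proj \<gamma> (Inl (Vertex v)) \<notin> ?R" by (simp add: proj_def)
    moreover have "Vertex v \<notin> ?R'" by simp
    ultimately show "Inl (Vertex v) \<in> preimage \<gamma> (insert (Vertex ?p) (inner_points ?B) - ?R) \<longleftrightarrow>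
        Inl (Vertex v) \<in> tangle_basic V E (fst \<gamma>) \<C> - Inl ` ?R'"
      using pV by (auto simp: preimage_def tangle_basic_iff[OF sub])
  next
    fix U :: "'a set \<Rightarrow> 'a set set set"
    have "proj \<gamma> (Inr U) = Vertex ?p \<longleftrightarrow> \<C> \<in> U (fst \<gamma>)" if "U \<in> ultrafilter_tangles V E"
      using proj_tangle_iff[OF g that C] .
    moreover have "proj \<gamma> (Inr U) \<notin> inner_points ?B" "proj \<gamma> (Inr U) \<notin> ?R" by (simp_all add: proj_def)
    ultimately show "Inr U \<in> preimage \<gamma> (insert (Vertex ?p) (inner_points ?B) - ?R) \<longleftrightarrow>
        Inr U \<in> tangle_basic V E (fst \<gamma>) \<C> - Inl ` ?R'"
      by (auto simp: preimage_def tangle_basic_iff[OF sub])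
  next
    fix e t
    show "Inl (Inner e t) \<in> preimage \<gamma> (insert (Vertex ?p) (inner_points ?B) - ?R) \<longleftrightarrow>
        Inl (Inner e t) \<in> tangle_basic V E (fst \<gamma>) \<C> - Inl ` ?R'"
    proof (cases "e \<in> E \<and> 0 < t \<and> t < 1")
      case et: True
      then have z: "Inl (Inner e t) \<in> topspace (tangle_compactification V E)" by simp
      have m: "Inl (Inner e t) \<in> Inl ` ?R' \<longleftrightarrow> Inner e t \<in> (?R :: ('a set, 'a set) cpoint set)" by simp
      show ?thesis
      proof (cases "e \<in> quot_edges E \<gamma>")
        case True
        then have "\<not> e \<subseteq> ?p" using quot_edge_not_subset[OF g _ dummies_vpart[OF d]] by blast
        then show ?thesis
          unfolding Diff_iff m tangle_basic_iff[OF sub] preimage_def mem_Collect_eq proj_Inner[OF True]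
          using et by simp
      next
        case False
        then have nB: "e \<notin> ?B" using edges_between_quot[OF g] by blast
        then have "e \<notin> F" using F by blast
        have "proj \<gamma> (Inl (Inner e t)) \<notin> inner_points ?B" "proj \<gamma> (Inl (Inner e t)) \<notin> ?R"
          using False by (simp_all add: proj_def)
        moreover have "proj \<gamma> (Inl (Inner e t)) = Vertex ?p \<longleftrightarrow> e \<subseteq> ?p"
          using proj_eq_dummy[OF g z C] by simp
        ultimately show ?thesis
          unfolding Diff_iff m tangle_basic_iff[OF sub] preimage_def mem_Collect_eq
          using et nB \<open>e \<notin> F\<close> by simp
      qed
    next
      case False
      then show ?thesis by (auto simp: preimage_def tangle_basic_iff[OF sub])
    qed
  qed
qed

section \<open>Continuity of the projections\<close>

lemma openin_tangle_Inl:
  "openin (one_complex V E) S \<Longrightarrow> openin (tangle_compactification V E) (Inl ` S)"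
  unfolding tangle_compactification_def by (intro topology_generated_by_Basis) blast

lemma openin_tangle_basic:
  assumes "X \<in> finite_vertex_sets V" "\<C> \<subseteq> comps V E X"
  shows "openin (tangle_compactification V E) (tangle_basic V E X \<C>)"
  unfolding tangle_compactification_def using assms by (intro topology_generated_by_Basis) blast

text \<open>Each trimmed interval starts at the end in X and includes its point at distance
  \<open>j e\<close>; what is left of the edge is an open interval reaching to the end in the
  dummy.\<close>

lemma openin_graph_part_dummy:
  assumes g: "\<gamma> \<in> index_set V E" and C: "\<C> \<in> snd \<gamma>"
    and j: "\<And>e. 0 < j e \<and> j e < (1::real)"
  shows "openin (one_complex V E) {w. Inl w \<in> tangle_basic V E (fst \<gamma>) \<C> \<and> w \<notin> removed F (fst \<gamma>) j}"
    (is "openin _ ?W")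
proof -
  note sub = index_block_subset[OF g C]
  have d: "\<Union>\<C> \<in> dummies \<gamma>" using C by (simp add: dummies_def)
  note pV = dummy_subset[OF g d]
  show ?thesis
  proof (rule openin_one_complexI)
    show "?W \<subseteq> complex_points V E"
    proof
      fix w assume w: "w \<in> ?W"
      then show "w \<in> complex_points V E"
        by (cases w) (use pV in \<open>auto simp: tangle_basic_iff[OF sub] simp del: Union_iff\<close>)
    qed
  next
    fix e t assume W: "Inner e t \<in> ?W"
    then have et: "0 < t" "t < 1" "e \<in> E" "e \<subseteq> \<Union>\<C> \<or> e \<in> edges_between E (fst \<gamma>) (\<Union>\<C>)"
      by (simp_all add: tangle_basic_iff[OF sub])
    have mem: "Inner e s \<in> ?W"
      if "0 < s" "s < 1" "\<And>x. x \<in> e \<inter> fst \<gamma> \<Longrightarrow> e \<in> F \<Longrightarrow> j e < dist_from x e s" for s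
      using that et(3,4) unfolding mem_Collect_eq tangle_basic_iff[OF sub] removed_iff by force
    show "\<exists>a b. 0 \<le> a \<and> a < t \<and> t < b \<and> b \<le> 1 \<and> Inner e ` {a<..<b} \<subseteq> ?W"
    proof (cases "e \<in> F \<and> e \<inter> fst \<gamma> \<noteq> {}")
      case False
      then have "Inner e ` {0<..<1} \<subseteq> ?W" using mem by (intro image_subsetI) auto
      then show ?thesis using et by (intro exI[of _ 0] exI[of _ 1]) simp
    next
      case True
      then have "\<not> e \<subseteq> \<Union>\<C>" using pV by blast
      then obtain x u where xu: "x \<in> fst \<gamma>" "u \<in> \<Union>\<C>" "e = {x, u}" using et(4) by (auto simp: edges_between_def)
      have ex: "e \<inter> fst \<gamma> = {x}" using xu pV by blast
      have *: "j e < dist_from x e t"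
      proof -
        have "0 < dist_from x e t" using et by (auto simp: dist_from_def)
        then show ?thesis using W True ex by auto
      qed
      \<comment> \<open>The parameter runs from \<open>edge_base e\<close>, so the remaining
        interval is \<open>{j e<..<1}\<close> or \<open>{0<..<1 - j e}\<close>, according to which
        end lies in X.\<close>
      show ?thesis
      proof (cases "x = edge_base e")
        case True
        have "Inner e ` {j e<..<1} \<subseteq> ?W"
        proof (intro image_subsetI mem)
          fix s assume s: "s \<in> {j e<..<1}"
          then show "0 < s" "s < 1" using j[of e] by auto
          show "j e < dist_from y e s" if "y \<in> e \<inter> fst \<gamma>" for y
            using that ex s True by (auto simp: dist_from_def)
        qed
        then show ?thesis using * et j[of e] True by (intro exI[of _ "j e"] exI[of _ 1]) (simp add: dist_from_def)
      next
        case False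
        have "Inner e ` {0<..<1 - j e} \<subseteq> ?W"
        proof (intro image_subsetI mem)
          fix s assume s: "s \<in> {0<..<1 - j e}"
          then show "0 < s" "s < 1" using j[of e] by auto
          show "j e < dist_from y e s" if "y \<in> e \<inter> fst \<gamma>" for y
            using that ex s False by (auto simp: dist_from_def)
        qed
        then show ?thesis using * et j[of e] False
          by (intro exI[of _ 0] exI[of _ "1 - j e"]) (simp add: dist_from_def)
      qed
    qed
  next
    fix u e assume W: "Vertex u \<in> ?W" and e: "e \<in> E" "u \<in> e"
    have u: "u \<in> \<Union>\<C>" using W unfolding mem_Collect_eq tangle_basic_iff[OF sub] ..
    show "\<exists>r. 0 < r \<and> r < 1 \<and> at_dist u e ` {0<..<r} \<subseteq> ?W"
      using g e(1) d e(2) u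
    proof (cases rule: edge_cases_dummy)
      case 1
      then have ex: "e \<inter> fst \<gamma> = {}" using pV by blast
      have "at_dist u e s \<in> ?W" if "s \<in> {0<..<1/2}" for s
        using that 1(1) e(1) ex by (simp add: at_dist_def tangle_basic_iff[OF sub] del: Union_iff)
      then show ?thesis by (intro exI[of _ "1/2"]) auto
    next
      case (2 x)
      have ex: "e \<inter> fst \<gamma> = {x}" using 2 u pV by blast
      \<comment> \<open>A distance below \<open>1 - j e\<close> from \<open>u\<close> is a distance
        above \<open>j e\<close> from the end \<open>x\<close> in X, hence beyond the trimmed
        interval.\<close>
      have "at_dist u e s \<in> ?W" if s: "s \<in> {0<..<1 - j e}" for s
      proof -
        define t where "t = (if u = edge_base e then s else 1 - s)"
        have t: "at_dist u e s = Inner e t" "dist_from u e t = s" "0 < t" "t < 1"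
          using s j[of e] by (auto simp: at_dist_def t_def dist_from_def)
        have "j e < dist_from x e t" using dist_from_other_end[OF 2(2,3)] t(2) s by simp
        then show ?thesis
          using t(3,4) e(1) 2(4) ex unfolding t(1) mem_Collect_eq tangle_basic_iff[OF sub] removed_iff by simp
      qed
      then show ?thesis using j[of e] by (intro exI[of _ "1 - j e"]) auto
    qed
  qed
qed

text \<open>The graph part is open already; the tangles need a neighbourhood avoiding the trimmed
  edges. Over \<open>Y\<close>, which adds all ends of edges in \<open>F\<close> and is finite
  because \<open>F\<close> is, the preimage \<open>\<D>\<close> of \<open>\<C>\<close> lies in the
  same tangles. Every edge in its basic set has an end in \<open>\<Union>\<D>\<close>, outside
  \<open>Y\<close>, so it is not in \<open>F\<close>.\<close>

lemma openin_tangle_basic_minus_removed: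
  assumes g: "\<gamma> \<in> index_set V E" and C: "\<C> \<in> snd \<gamma>"
    and j: "\<And>e. 0 < j e \<and> j e < (1::real)" and F: "finite F" "F \<subseteq> E"
  shows "openin (tangle_compactification V E) (tangle_basic V E (fst \<gamma>) \<C> - Inl ` removed F (fst \<gamma>) j)"
    (is "openin _ ?S")
proof -
  note sub = index_block_subset[OF g C]
  note X = index_setD(1)[OF g]
  have d: "\<Union>\<C> \<in> dummies \<gamma>" using C by (simp add: dummies_def)
  note pV = dummy_subset[OF g d]
  define W where "W = {w. Inl w \<in> tangle_basic V E (fst \<gamma>) \<C> \<and> w \<notin> removed F (fst \<gamma>) j}"
  define Y where "Y = fst \<gamma> \<union> \<Union>F"
  define \<D> where "\<D> = comps_in Y (\<Union>\<C>)"
  have Y: "Y \<in> finite_vertex_sets V"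
    using X F edge_finite_vertex_set unfolding Y_def finite_vertex_sets_def by blast
  have D: "\<D> \<subseteq> comps V E Y" "\<Union>\<D> \<subseteq> \<Union>\<C>" by (auto simp: \<D>_def comps_in_def)
  have DY: "\<Union>\<D> \<inter> Y = {}" using comps_subset D(1) by blast
  have tangle: "\<C> \<in> U (fst \<gamma>) \<longleftrightarrow> \<D> \<in> U Y" if "U \<in> ultrafilter_tangles V E" for U
    unfolding \<D>_def using tangle_iff[OF that X Y _ sub] by (simp add: Y_def)
  have edge: "Inl (Inner e t) \<in> ?S" if m: "Inl (Inner e t) \<in> tangle_basic V E Y \<D>" for e t
  proof -
    have et: "0 < t" "t < 1" "e \<in> E" "e \<subseteq> \<Union>\<D> \<or> e \<in> edges_between E Y (\<Union>\<D>)"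
      using m unfolding tangle_basic_iff[OF D(1)] by auto
    have "e \<noteq> {}" using edgeE[OF et(3)] by blast
    moreover have "\<exists>u\<in>e. u \<in> B" if "e \<in> edges_between E A B" for A B
      using that by (auto simp: edges_between_def)
    ultimately obtain u where u: "u \<in> e" "u \<in> \<Union>\<D>" using et(4) by (metis ex_in_conv subsetD)
    then have "e \<notin> F" using DY unfolding Y_def by blast
    moreover have "u \<in> \<Union>\<C>" using u(2) D(2) by blast
    have "e \<subseteq> \<Union>\<C> \<or> e \<in> edges_between E (fst \<gamma>) (\<Union>\<C>)"
      using g et(3) d u(1) \<open>u \<in> \<Union>\<C>\<close> by (cases rule: edge_cases_dummy) simp_all
    ultimately show ?thesis using et(1-3) by (auto simp: tangle_basic_iff[OF sub] simp del: Union_iff)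
  qed
  have "?S = Inl ` W \<union> tangle_basic V E Y \<D>"
  proof (rule tpoint_set_eqI)
    fix v
    show "Inl (Vertex v) \<in> ?S \<longleftrightarrow> Inl (Vertex v) \<in> Inl ` W \<union> tangle_basic V E Y \<D>"
      using D(2) by (auto simp: W_def tangle_basic_iff[OF sub] tangle_basic_iff[OF D(1)] simp del: Union_iff)
  next
    fix e t
    show "Inl (Inner e t) \<in> ?S \<longleftrightarrow> Inl (Inner e t) \<in> Inl ` W \<union> tangle_basic V E Y \<D>"
      using edge[of e t] unfolding W_def by blast
  next
    fix U
    show "Inr U \<in> ?S \<longleftrightarrow> Inr U \<in> Inl ` W \<union> tangle_basic V E Y \<D>"
      using tangle[of U] by (auto simp: tangle_basic_iff[OF sub] tangle_basic_iff[OF D(1)])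
  qed
  moreover have "openin (tangle_compactification V E) (Inl ` W)"
    unfolding W_def by (rule openin_tangle_Inl[OF openin_graph_part_dummy[OF g C j]])
  ultimately show ?thesis using openin_tangle_basic[OF Y D(1)] by auto
qed

lemma continuous_map_proj:
  assumes g: "\<gamma> \<in> index_set V E"
  shows "continuous_map (tangle_compactification V E) (quot_complex E \<gamma>) (proj \<gamma>)"
proof -
  have vimage: "proj \<gamma> -` S \<inter> topspace (tangle_compactification V E) = preimage \<gamma> S" for S
    by (auto simp: preimage_def)
  have "openin (tangle_compactification V E) (preimage \<gamma> S)"
    if S: "S \<in> edge_intervals (quot_edges E \<gamma>) \<union> (\<Union>x\<in>fst \<gamma>. vertex_stars (quot_edges E \<gamma>) x {x})
      \<union> (\<Union>p\<in>dummies \<gamma>. dummy_nbhds E (fst \<gamma>) p)" for S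
  proof -
    from S consider "S \<in> edge_intervals (quot_edges E \<gamma>)"
      | x where "x \<in> fst \<gamma>" "S \<in> vertex_stars (quot_edges E \<gamma>) x {x}"
      | p where "p \<in> dummies \<gamma>" "S \<in> dummy_nbhds E (fst \<gamma>) p" by blast
    then show ?thesis
    proof cases
      case 1
      then obtain e a b where e: "S = Inner e ` {a<..<b}" "e \<in> quot_edges E \<gamma>" "0 \<le> a" "a < b" "b \<le> 1"
        unfolding edge_intervals_def by blast
      then have "Inner e ` {a<..<b} \<in> edge_intervals E"
        using quot_edges_subset[of \<gamma>] unfolding edge_intervals_def by blast
      then have "openin (one_complex V E) (Inner e ` {a<..<b})"
        unfolding one_complex_def by (intro topology_generated_by_Basis) blast
      then show ?thesis using preimage_edge_interval[OF g e(2,3,5)] openin_tangle_Inl e(1) by simp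
    next
      case 2
      then obtain j where j: "\<And>e. 0 < j e \<and> j e < (1::real)"
        and S': "S = insert (Vertex {x}) (\<Union>e\<in>{e\<in>quot_edges E \<gamma>. x \<in> e}. at_dist x e ` {0<..<j e})"
        unfolding vertex_stars_def by blast
      let ?T = "insert (Vertex x) (\<Union>e\<in>{e\<in>E. x \<in> e}. at_dist x e ` {0<..<j e})"
      have "?T \<in> vertex_stars E x x" using j unfolding vertex_stars_def by blast
      moreover have "x \<in> V" using 2(1) index_setD(2)[OF g] by blast
      ultimately have "openin (one_complex V E) ?T"
        unfolding one_complex_def by (intro topology_generated_by_Basis) blast
      then show ?thesis unfolding S' preimage_star[where j = j, OF g 2(1) j] by (rule openin_tangle_Inl)
    next
      case 3
      then obtain F j where j: "\<And>e. 0 < j e \<and> j e < (1::real)"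
        and F: "finite F" "F \<subseteq> edges_between E (fst \<gamma>) p"
        and S': "S = insert (Vertex p) (inner_points (edges_between E (fst \<gamma>) p)) - removed F (fst \<gamma>) j"
        unfolding dummy_nbhds_def removed_def by blast
      obtain \<C> where C: "\<C> \<in> snd \<gamma>" "p = \<Union>\<C>" using 3(1) by (auto simp: dummies_def)
      have "F \<subseteq> edges_between E (fst \<gamma>) (\<Union>\<C>)" using F(2) C(2) by blast
      moreover have "F \<subseteq> E" using F(2) by (auto simp: edges_between_def)
      ultimately show ?thesis
        using preimage_dummy[where F = F and j = j, OF g C(1)] openin_tangle_basic_minus_removed[OF g C(1) j F(1)] S' C(2) by simp
    qed
  qed
  moreover have "proj \<gamma> ` topspace (tangle_compactification V E) \<subseteq> topspace (quot_complex E \<gamma>)"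
    using proj_in_quot_points[OF g] topspace_quot_complex[OF g] by blast
  ultimately show ?thesis
    unfolding quot_complex_def by (intro continuous_on_generated_topo) (simp_all only: vimage topology_generated_by_topspace)
qed

section \<open>The homeomorphism\<close>

text \<open>Restricted because the points of a product topology are extensional functions.\<close>

definition to_limit :: "'a tpoint \<Rightarrow> 'a gidx \<Rightarrow> ('a set, 'a set) cpoint" where
  "to_limit z = restrict (\<lambda>\<gamma>. proj \<gamma> z) (index_set V E)"

lemma graph_inverse_limit_topspace:
  "topspace (graph_inverse_limit V E) =
    {z \<in> \<Pi>\<^sub>E \<gamma>\<in>index_set V E. quot_points E \<gamma>.
      \<forall>\<gamma>\<in>index_set V E. \<forall>\<delta>\<in>index_set V E. index_le V \<gamma> \<delta> \<longrightarrow> bonding_map E \<delta> \<gamma> (z \<delta>) = z \<gamma>}"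
proof -
  have "(\<Pi>\<^sub>E \<gamma>\<in>index_set V E. topspace (quot_complex E \<gamma>)) = (\<Pi>\<^sub>E \<gamma>\<in>index_set V E. quot_points E \<gamma>)"
    by (rule PiE_cong) (rule topspace_quot_complex)
  then show ?thesis
    unfolding graph_inverse_limit_def inverse_limit_def topspace_subtopology topspace_product_topology comp_def
    by auto
qed

lemma to_limit_image:
  "to_limit ` topspace (tangle_compactification V E) = topspace (graph_inverse_limit V E)"
proof
  show "to_limit ` topspace (tangle_compactification V E) \<subseteq> topspace (graph_inverse_limit V E)"
    unfolding graph_inverse_limit_topspace to_limit_def
    using proj_in_quot_points bonding_map_proj by (intro image_subsetI) simp
  show "topspace (graph_inverse_limit V E) \<subseteq> to_limit ` topspace (tangle_compactification V E)"
  proof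
    fix z assume "z \<in> topspace (graph_inverse_limit V E)"
    then have z: "z \<in> (\<Pi>\<^sub>E \<gamma>\<in>index_set V E. quot_points E \<gamma>)"
      "\<And>\<gamma> \<delta>. \<gamma> \<in> index_set V E \<Longrightarrow> \<delta> \<in> index_set V E \<Longrightarrow> index_le V \<gamma> \<delta> \<Longrightarrow> bonding_map E \<delta> \<gamma> (z \<delta>) = z \<gamma>"
      unfolding graph_inverse_limit_topspace by blast+
    obtain w where w: "w \<in> topspace (tangle_compactification V E)" "\<forall>\<gamma>\<in>index_set V E. proj \<gamma> w = z \<gamma>"
      using proj_surj[OF z(2) PiE_mem[OF z(1)]] by blast
    have "to_limit w = z"
      using w(2) PiE_arb[OF z(1)] by (auto simp: to_limit_def restrict_def)
    then show "z \<in> to_limit ` topspace (tangle_compactification V E)" using w(1) by blast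
  qed
qed

lemma inj_on_to_limit: "inj_on to_limit (topspace (tangle_compactification V E))"
proof (rule inj_onI)
  fix z w assume zw: "z \<in> topspace (tangle_compactification V E)" "w \<in> topspace (tangle_compactification V E)"
    "to_limit z = to_limit w"
  have "proj \<gamma> z = proj \<gamma> w" if "\<gamma> \<in> index_set V E" for \<gamma>
    using fun_cong[OF zw(3), of \<gamma>] that by (simp add: to_limit_def)
  then show "z = w" by (rule proj_inj[OF zw(1,2)])
qed

lemma continuous_map_to_limit:
  "continuous_map (tangle_compactification V E) (graph_inverse_limit V E) to_limit"
proof -
  have "continuous_map (tangle_compactification V E) (product_topology (quot_complex E) (index_set V E)) to_limit"
    unfolding continuous_map_componentwise
    using continuous_map_proj by (auto simp: to_limit_def)
  moreover have "to_limit \<in> topspace (tangle_compactification V E) \<rightarrow>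
      {z. \<forall>\<gamma>\<in>index_set V E. \<forall>\<delta>\<in>index_set V E. index_le V \<gamma> \<delta> \<longrightarrow> bonding_map E \<delta> \<gamma> (z \<delta>) = z \<gamma>}"
    using bonding_map_proj by (simp add: to_limit_def)
  ultimately show ?thesis
    unfolding graph_inverse_limit_def inverse_limit_def continuous_map_in_subtopology by blast
qed

text \<open>Following \<open>to_limit\<close> by a coordinate projection gives
  \<open>proj \<gamma>\<close>, and \<open>to_limit\<close> is onto. The image is therefore the
  preimage of \<open>S\<close> under that coordinate, so a set is shown to have open image by
  writing it as a \<open>preimage\<close>.\<close>

lemma openin_to_limit_preimage:
  assumes g: "\<gamma> \<in> index_set V E" and S: "openin (quot_complex E \<gamma>) S"
  shows "openin (graph_inverse_limit V E) (to_limit ` preimage \<gamma> S)"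
proof -
  have "continuous_map (graph_inverse_limit V E) (quot_complex E \<gamma>) (\<lambda>z. z \<gamma>)"
    unfolding graph_inverse_limit_def inverse_limit_def
    by (intro continuous_map_from_subtopology continuous_map_product_projection g)
  from openin_continuous_map_preimage[OF this S]
  have "openin (graph_inverse_limit V E) {z \<in> topspace (graph_inverse_limit V E). z \<gamma> \<in> S}" .
  moreover have "{z \<in> topspace (graph_inverse_limit V E). z \<gamma> \<in> S} = to_limit ` preimage \<gamma> S"
    unfolding to_limit_image[symmetric] preimage_def using g by (auto simp: to_limit_def)
  ultimately show ?thesis by simp
qed

text \<open>One index suffices for each generator of the 1-complex: deleting both ends of the edge
  for an interval, deleting the centre for a star. Injectivity extends this to all open
  sets.\<close>

lemma openin_to_limit_graph:
  assumes "openin (one_complex V E) S"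
  shows "openin (graph_inverse_limit V E) (to_limit ` Inl ` S)"
proof -
  let ?gen = "edge_intervals E \<union> (\<Union>u\<in>V. vertex_stars E u u)"
  have "generate_topology_on ?gen S"
    using assms unfolding one_complex_def by (rule openin_topology_generated_by)
  moreover have "inj_on (to_limit \<circ> Inl) (\<Union>?gen)"
  proof -
    have "Inl ` \<Union>?gen \<subseteq> topspace (tangle_compactification V E)"
      using topspace_one_complex[of V E]
      unfolding one_complex_def topology_generated_by_topspace topspace_tangle_compactification by blast
    then show ?thesis by (intro comp_inj_on) (auto intro: inj_on_subset[OF inj_on_to_limit])
  qed
  moreover have "openin (graph_inverse_limit V E) ((to_limit \<circ> Inl) ` B)" if B: "B \<in> ?gen" for B
  proof -
    from B consider "B \<in> edge_intervals E" | u where "u \<in> V" "B \<in> vertex_stars E u u" by blast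
    then have "openin (graph_inverse_limit V E) (to_limit ` Inl ` B)"
    proof cases
      case 1
      then obtain e a b where e: "B = Inner e ` {a<..<b}" "e \<in> E" "0 \<le> a" "a < b" "b \<le> 1"
        unfolding edge_intervals_def by blast
      note i = split_index[OF edge_finite_vertex_set[OF e(2)] empty_subsetI]
      let ?\<gamma> = "split_index e {}"
      obtain x where "x \<in> e" using edgeE[OF e(2)] by blast
      then have q: "e \<in> quot_edges E ?\<gamma>" using edge_at_vertex_quot[OF i(1) e(2)] i(2) by simp
      then have "Inner e ` {a<..<b} \<in> edge_intervals (quot_edges E ?\<gamma>)"
        using e unfolding edge_intervals_def by blast
      then have "openin (quot_complex E ?\<gamma>) (Inner e ` {a<..<b})"
        unfolding quot_complex_def by (intro topology_generated_by_Basis) blast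
      from openin_to_limit_preimage[OF i(1) this] show ?thesis
        unfolding preimage_edge_interval[OF i(1) q e(3,5)] e(1) .
    next
      case 2
      then obtain j where j: "\<And>e. 0 < j e \<and> j e < (1::real)"
        and B': "B = insert (Vertex u) (\<Union>e\<in>{e\<in>E. u \<in> e}. at_dist u e ` {0<..<j e})"
        unfolding vertex_stars_def by blast
      have X: "{u} \<in> finite_vertex_sets V" using 2(1) by (simp add: finite_vertex_sets_def)
      note i = split_index[OF X empty_subsetI]
      let ?\<gamma> = "split_index {u} {}"
      have u: "u \<in> fst ?\<gamma>" using i(2) by simp
      let ?T = "insert (Vertex {u}) (\<Union>e\<in>{e\<in>quot_edges E ?\<gamma>. u \<in> e}. at_dist u e ` {0<..<j e})"
      have "?T \<in> vertex_stars (quot_edges E ?\<gamma>) u {u}" using j unfolding vertex_stars_def by blast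
      then have "openin (quot_complex E ?\<gamma>) ?T"
        unfolding quot_complex_def using u by (intro topology_generated_by_Basis) blast
      from openin_to_limit_preimage[OF i(1) this] show ?thesis
        unfolding preimage_star[where j = j, OF i(1) u j] B' .
    qed
    then show ?thesis by (simp only: image_comp)
  qed
  ultimately have "openin (graph_inverse_limit V E) ((to_limit \<circ> Inl) ` S)" by (rule openin_image_generated)
  then show ?thesis by (simp only: image_comp)
qed

lemma openin_to_limit_tangle_basic:
  assumes X: "X \<in> finite_vertex_sets V" and C: "\<C> \<subseteq> comps V E X"
  shows "openin (graph_inverse_limit V E) (to_limit ` tangle_basic V E X \<C>)"
proof (cases "\<C> = {}")
  case True
  \<comment> \<open>The empty family has no dummy vertex, but its basic set is empty because
    ultrafilters omit the empty set.\<close>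
  have "tangle_basic V E X {} = {}"
  proof -
    have "{} \<notin> U X" if "U \<in> ultrafilter_tangles V E" for U
      using ultrafilter_onD(2)[OF tangle_ultrafilter[OF that X]] .
    then show ?thesis by (auto simp: tangle_basic_def edges_between_def inner_points_def)
  qed
  then show ?thesis using True by simp
next
  case False
  note i = split_index[OF X C]
  let ?\<gamma> = "split_index X \<C>"
  \<comment> \<open>No edge is trimmed, so the preimage is the whole basic set; \<open>1/2\<close>
    is an arbitrary admissible value of the trimming function.\<close>
  let ?T = "insert (Vertex (\<Union>\<C>)) (inner_points (edges_between E (fst ?\<gamma>) (\<Union>\<C>))) - removed {} (fst ?\<gamma>) (\<lambda>_. 1/2)"
  have "?T \<in> dummy_nbhds E (fst ?\<gamma>) (\<Union>\<C>)"
    unfolding dummy_nbhds_def removed_def by (intro CollectI exI[of _ "{}"] exI[of _ "\<lambda>_. 1/2"]) simp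
  moreover have "\<Union>\<C> \<in> dummies ?\<gamma>" using i(3)[OF False] by (simp add: dummies_def)
  ultimately have "openin (quot_complex E ?\<gamma>) ?T"
    unfolding quot_complex_def by (intro topology_generated_by_Basis) blast
  from openin_to_limit_preimage[OF i(1) this] show ?thesis
    unfolding preimage_dummy[OF i(1) i(3)[OF False] empty_subsetI]
    by (simp add: removed_def i(2))
qed

lemma homeomorphic_map_to_limit:
  "homeomorphic_map (tangle_compactification V E) (graph_inverse_limit V E) to_limit"
proof (rule bijective_open_imp_homeomorphic_map)
  let ?gen = "{Inl ` S | S. openin (one_complex V E) S} \<union>
        {tangle_basic V E X \<C> | X \<C>. X \<in> finite_vertex_sets V \<and> \<C> \<subseteq> comps V E X}"
  show "open_map (tangle_compactification V E) (graph_inverse_limit V E) to_limit"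
    unfolding open_map_def
  proof (intro allI impI)
    fix S assume "openin (tangle_compactification V E) S"
    then have "generate_topology_on ?gen S"
      unfolding tangle_compactification_def by (rule openin_topology_generated_by)
    moreover have "inj_on to_limit (\<Union>?gen)"
      using inj_on_to_limit unfolding tangle_compactification_def topology_generated_by_topspace .
    moreover have "openin (graph_inverse_limit V E) (to_limit ` B)" if "B \<in> ?gen" for B
      using that openin_to_limit_graph openin_to_limit_tangle_basic by blast
    ultimately show "openin (graph_inverse_limit V E) (to_limit ` S)" by (rule openin_image_generated)
  qed
qed (rule continuous_map_to_limit to_limit_image inj_on_to_limit)+

end

theorem theorem4p3p1:
  fixes V :: "'a set" and E :: "'a set set"
  assumes "simple_graph V E" and "infinite V"
  shows "tangle_compactification V E homeomorphic_space graph_inverse_limit V E"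
proof -
  interpret sgraph V E by unfold_locales (rule assms(1))
  show ?thesis by (rule homeomorphic_map_imp_homeomorphic_space[OF homeomorphic_map_to_limit])
qed

end
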